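(* For every $\delta\in(0,1)$ there is a constant $C=C(\delta)>0$ such that the following holds. Let $k\ge 1$ be an integer, $\sigma>0$, $\epsilon>0$. Then for every integer $m\ge C\,k^3\exp\big(C(\sigma/\epsilon)^{2/3}\big)$ there is an algorithm (an estimator depending only on $k,\sigma,\epsilon,m$, i.e. a measurable map from $\mathbb{R}^m$ to the $k$-element subsets of $\epsilon\mathbb{Z}$) such that for every choice of distinct means $\mu_1,\dots,\mu_k\in\epsilon\mathbb{Z}$, when the algorithm is given $m$ independent samples from the uniform mixture $\mathcal{M}=\frac1k\sum_{i=1}^k\mathcal{N}(\mu_i,\sigma^2)$, it outputs exactly the set $\{\mu_1,\dots,\mu_k\}$ with probability at least $1-\delta$.
   Context: $\mathcal{N}(\mu,\sigma^2)$ is the univariate Gaussian distribution with mean $\mu$ and variance $\sigma^2$; $\epsilon\mathbb{Z}=\{\epsilon j: j\in\mathbb{Z}\}$. The mixture $\frac1k\sum_i f_i$ is the distribution whose density is the average of the densities of its components. The common variance $\sigma^2$ is known. *)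

theory Defs
  imports "HOL-Probability.Probability"
begin

definition scaled_integers :: "real \<Rightarrow> real set" where
  "scaled_integers \<epsilon> = {\<epsilon> * of_int j | j :: int. True}"

text \<open>The second argument of \<open>normal_density\<close> is the standard deviation, so the components
  have variance \<open>\<sigma>\<^sup>2\<close>.\<close>

definition gaussian_mixture :: "nat \<Rightarrow> (nat \<Rightarrow> real) \<Rightarrow> real \<Rightarrow> real measure" where
  "gaussian_mixture k \<mu> \<sigma> =
     density lborel (\<lambda>x. ennreal ((1 / real k) * (\<Sum>i<k. normal_density (\<mu> i) \<sigma> x)))"

lemma sets_gaussian_mixture [measurable_cong, simp]: "sets (gaussian_mixture k \<mu> \<sigma>) = sets borel"
  by (simp add: gaussian_mixture_def)

lemma space_gaussian_mixture [simp]: "space (gaussian_mixture k \<mu> \<sigma>) = UNIV"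
  by (simp add: gaussian_mixture_def)

lemma prob_space_gaussian_mixture:
  assumes "k \<ge> 1" and "\<sigma> > 0"
  shows "prob_space (gaussian_mixture k \<mu> \<sigma>)"
proof
  have 1: "(\<integral>\<^sup>+x. ennreal (normal_density (\<mu> i) \<sigma> x) \<partial>lborel) = 1" for i
    using prob_space.emeasure_space_1[OF prob_space_normal_density[OF assms(2), of "\<mu> i"]]
    by (simp add: emeasure_density)
  have "emeasure (gaussian_mixture k \<mu> \<sigma>) (space (gaussian_mixture k \<mu> \<sigma>)) =
      (\<integral>\<^sup>+x. ennreal (1 / real k) * (\<Sum>i<k. ennreal (normal_density (\<mu> i) \<sigma> x)) \<partial>lborel)"
    unfolding gaussian_mixture_def
    by (subst emeasure_density)
      (auto intro!: nn_integral_cong simp: ennreal_mult sum_nonneg sum_ennreal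
        simp del: times_divide_eq_left)
  also have "\<dots> = ennreal (1 / real k) * of_nat k"
    by (simp add: nn_integral_cmult nn_integral_sum 1 del: sum_ennreal)
  also have "\<dots> = 1"
    using assms(1) by (simp add: ennreal_of_nat_eq_real_of_nat flip: ennreal_mult)
  finally show "emeasure (gaussian_mixture k \<mu> \<sigma>) (space (gaussian_mixture k \<mu> \<sigma>)) = 1" .
qed

text \<open>The law of \<open>m\<close> independent samples: a sample vector in \<open>\<real>\<^sup>m\<close> is an extensional function
  on \<open>{..<m}\<close>.\<close>

definition iid_samples :: "nat \<Rightarrow> real measure \<Rightarrow> (nat \<Rightarrow> real) measure" where
  "iid_samples m M = (\<Pi>\<^sub>M i\<in>{..<m}. M)"

text \<open>For \<open>\<epsilon> > 0\<close> there are only countably many \<open>k\<close>-element subsets of the lattice, so the codomain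
  carries its natural discrete \<open>\<sigma>\<close>-algebra.\<close>

definition mean_estimators :: "nat \<Rightarrow> real \<Rightarrow> nat \<Rightarrow> ((nat \<Rightarrow> real) \<Rightarrow> real set) set" where
  "mean_estimators k \<epsilon> m =
     measurable (\<Pi>\<^sub>M i\<in>{..<m}. borel)
       (count_space {S. S \<subseteq> scaled_integers \<epsilon> \<and> finite S \<and> card S = k})"

end

theory Submission
  imports Defs
begin

text \<open>Put \<open>r = \<sigma> / \<epsilon>\<close>. The entire function \<open>s z = (sin (2 \<surd>z) / (2 \<surd>z)) ^ 4\<close> has order \<open>1/2\<close>, with
  \<open>s 0 = 1\<close> and \<open>\<bar>s n\<bar> \<le> 1 / (16 n\<^sup>2)\<close> at the positive integers. Hence for two different finite sets of
  lattice points the sums of the profile \<open>f x = exp (- x\<^sup>2 / (4 \<sigma>\<^sup>2)) * s (x / \<epsilon>)\<close>, recentred at the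
  smallest point of the symmetric difference, differ by more than \<open>1/2\<close>; nothing is required of
  \<open>s\<close> on the negative axis, where it is huge.

  The profile is the Gaussian smoothing of an explicit probe function \<open>g\<close>: inverting the heat flow
  replaces the powers \<open>x ^ k\<close> in the series of \<open>s\<close> by Hermite polynomials, and because \<open>s\<close> grows like
  \<open>exp (C \<surd>\<bar>z\<bar>)\<close> while the Gaussian factors decay on the scale \<open>\<sigma>\<close>, one gets
  \<open>\<bar>g v\<bar> \<le> 5 exp (96 r powr (2/3)) exp (- v\<^sup>2 / (4 \<sigma>\<^sup>2))\<close>: the exponent \<open>2/3\<close> comes from maximising
  \<open>\<surd>(r t) - t\<^sup>2\<close>. The empirical means of all translates \<open>g (x - \<epsilon> n)\<close> are therefore simultaneously
  within \<open>1 / (4 k)\<close> of their expectations, by Chebyshev's inequality and summation over \<open>n\<close>, and the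
  estimator returns the first set of lattice points that is compatible with them.\<close>

section \<open>An entire function of order one half\<close>

text \<open>The Taylor coefficients of \<open>(sin (2 \<surd>z) / (2 \<surd>z)) ^ 4\<close>, from
  \<open>8 sin \<theta> ^ 4 = 3 - 4 cos (2 \<theta>) + cos (4 \<theta>)\<close>.\<close>

definition sinc_coeff :: "nat \<Rightarrow> real" where
  "sinc_coeff k = (-1) ^ k * (64 ^ (k + 2) - 4 * 16 ^ (k + 2)) / (128 * fact (2 * k + 4))"

lemma sinc_coeff_0 [simp]: "sinc_coeff 0 = 1"
  by (simp add: sinc_coeff_def fact_numeral)

text \<open>The subtracted term is dominated by \<open>64 ^ (k + 2)\<close>, and
  \<open>(2k + 4)!\<close> is at least \<open>24 (2k)!\<close>. What remains is, up to the factor 2,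
  the Taylor coefficient of \<open>cosh (8 * sqrt w)\<close>, an entire function of order one
  half.\<close>

lemma abs_sinc_coeff_le: "\<bar>sinc_coeff k\<bar> \<le> 2 * (64 ^ k / fact (2 * k))"
proof -
  have p: "(4::real) * 16 ^ (k + 2) \<le> 64 ^ (k + 2)"
  proof -
    have "(4::real) * 16 ^ (k + 2) \<le> 4 ^ (k + 2) * 16 ^ (k + 2)"
      using power_increasing[of 1 "k + 2" "4::real"] by (intro mult_right_mono) auto
    also have "\<dots> = 64 ^ (k + 2)"
      by (simp flip: power_mult_distrib)
    finally show ?thesis .
  qed
  have f: "(24::real) * fact (2 * k) \<le> fact (2 * k + 4)"
  proof -
    have "fact (2 * k + 4) = (2 * real k + 4) * ((2 * real k + 3) * ((2 * real k + 2) * ((2 * real k + 1) * fact (2 * k))))"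
      by (simp add: eval_nat_numeral algebra_simps)
    also have "\<dots> \<ge> 4 * (3 * (2 * (1 * fact (2 * k))))"
      by (intro mult_mono) auto
    finally show ?thesis by simp
  qed
  have "\<bar>sinc_coeff k\<bar> = (64 ^ (k + 2) - 4 * 16 ^ (k + 2)) / (128 * fact (2 * k + 4))"
    using p by (simp add: sinc_coeff_def abs_mult)
  also have "\<dots> \<le> 64 ^ (k + 2) / (128 * (24 * fact (2 * k)))"
    using p f by (intro frac_le) auto
  \<comment> \<open>The exact constant is \<open>64^2 / (128 * 24) = 4/3\<close>, rounded up to
    2.\<close>
  also have "\<dots> \<le> 2 * (64 ^ k / fact (2 * k))"
    by (simp add: field_simps)
  finally show ?thesis .
qed

text \<open>The bounds on the single terms are twice the even-indexed terms of the exponential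
  series at \<open>8 * sqrt w\<close>. The estimate is uniform in \<open>n\<close>, so it can be
  integrated against a Gaussian before any limit is taken.\<close>

lemma sinc_coeff_sum_le:
  assumes "w \<ge> 0"
  shows "(\<Sum>k<n. \<bar>sinc_coeff k\<bar> * w ^ k) \<le> 2 * exp (8 * sqrt w)"
proof -
  define u where "u = 8 * sqrt w"
  have u: "u \<ge> 0" using assms by (simp add: u_def)
  have u2: "u ^ (2 * k) = 64 ^ k * w ^ k" for k
    using assms by (simp add: u_def power_mult power_mult_distrib)
  have "(\<Sum>k<n. \<bar>sinc_coeff k\<bar> * w ^ k) \<le> (\<Sum>k<n. 2 * (u ^ (2 * k) / fact (2 * k)))"
  proof (rule sum_mono)
    fix k
    have "\<bar>sinc_coeff k\<bar> * w ^ k \<le> 2 * (64 ^ k / fact (2 * k)) * w ^ k"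
      using assms by (intro mult_right_mono abs_sinc_coeff_le) auto
    then show "\<bar>sinc_coeff k\<bar> * w ^ k \<le> 2 * (u ^ (2 * k) / fact (2 * k))"
      by (simp add: u2)
  qed
  also have "\<dots> = 2 * (\<Sum>i\<in>(\<lambda>k. 2 * k) ` {..<n}. u ^ i / fact i)"
    by (subst sum.reindex) (auto simp: sum_distrib_left inj_on_def)
  also have "(\<Sum>i\<in>(\<lambda>k. 2 * k) ` {..<n}. u ^ i / fact i) \<le> (\<Sum>i. u ^ i / fact i)"
    using summable_exp_generic[of u] u
    by (intro sum_le_suminf) (auto simp: field_simps)
  also have "(\<Sum>i. u ^ i / fact i) = exp u"
    by (simp add: exp_def field_simps)
  finally show ?thesis by (simp add: u_def)
qed

text \<open>The cosine series at \<open>8 * sqrt x\<close> minus four times the one at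
  \<open>4 * sqrt x\<close> sums to \<open>8 sin^4 - 3\<close>. Removing its first two terms and
  dividing by \<open>128 * x^2\<close> gives the claim.\<close>

lemma sinc_coeff_sums:
  assumes "x > 0"
  shows "(\<lambda>k. sinc_coeff k * x ^ k) sums (sin (2 * sqrt x) ^ 4 / (16 * x\<^sup>2))"
proof -
  define D where "D n = (-1) ^ n / fact (2 * n) * (64 ^ n - 4 * 16 ^ n) * x ^ n" for n :: nat
  have 8: "(8 * sqrt x) ^ (2 * n) = 64 ^ n * x ^ n" and 4: "(4 * sqrt x) ^ (2 * n) = 16 ^ n * x ^ n" for n
    using assms by (simp_all add: power_mult power_mult_distrib)
  have "D sums (cos (8 * sqrt x) - 4 * cos (4 * sqrt x))"
    using sums_diff[OF cos_paired[of "8 * sqrt x"] sums_mult[OF cos_paired[of "4 * sqrt x"], of 4]]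
    unfolding 8 4 by (simp add: D_def[abs_def] algebra_simps diff_divide_distrib)
  then have "(\<lambda>n. D (n + 2)) sums (cos (8 * sqrt x) - 4 * cos (4 * sqrt x) - (\<Sum>i<2. D i))"
    by (rule sums_split_initial_segment)
  \<comment> \<open>The constant term is 1 - 4, and the linear term vanishes because 64 = 4 * 16;
    hence division by \<open>x^2\<close> still leaves a power series.\<close>
  moreover have "(\<Sum>i<2. D i) = -3"
    by (simp add: D_def eval_nat_numeral)
  moreover have "cos (8 * sqrt x) - 4 * cos (4 * sqrt x) + 3 = 8 * sin (2 * sqrt x) ^ 4"
  proof -
    have "cos (8 * sqrt x) = 2 * (cos (4 * sqrt x))\<^sup>2 - 1"
      using cos_double_cos[of "4 * sqrt x"] by simp
    moreover have "cos (4 * sqrt x) = 1 - 2 * (sin (2 * sqrt x))\<^sup>2"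
      using cos_double_sin[of "2 * sqrt x"] by simp
    ultimately show ?thesis by algebra
  qed
  ultimately have "(\<lambda>n. D (n + 2) / (128 * x\<^sup>2)) sums (8 * sin (2 * sqrt x) ^ 4 / (128 * x\<^sup>2))"
    by (intro sums_divide) simp
  moreover have "D (n + 2) / (128 * x\<^sup>2) = sinc_coeff n * x ^ n" for n
  proof -
    have "2 * (n + 2) = 2 * n + 4" by simp
    then show ?thesis
      using assms unfolding D_def sinc_coeff_def
      by (simp only: power_add) (simp add: field_simps del: fact_Suc)
  qed
  ultimately show ?thesis by simp
qed

section \<open>Gaussian moments and inversion of the heat flow\<close>

definition gauss_moment :: "nat \<Rightarrow> real" where
  "gauss_moment j = (if even j then fact j / (2 ^ (j div 2) * fact (j div 2)) else 0)"

lemma has_bochner_integral_gauss_moment: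
  "has_bochner_integral lborel (\<lambda>x. std_normal_density x * x ^ j) (gauss_moment j)"
proof (cases "even j")
  case True
  then show ?thesis
    using std_normal_moment_even[of "j div 2"] by (simp add: gauss_moment_def)
next
  case False
  then have "2 * (j div 2) + 1 = j" by presburger
  then show ?thesis
    using std_normal_moment_odd[of "j div 2"] False by (simp add: gauss_moment_def)
qed

lemma gauss_moment_nonneg: "gauss_moment j \<ge> 0"
  by (simp add: gauss_moment_def)

text \<open>Absolute moments let a binomial sum recombine into one integral of a power of
  \<open>\<bar>v\<bar> + s * \<bar>y\<bar>\<close>, as done in
  \<open>abs_heat_poly_le\<close>.\<close>

lemma gauss_moment_le_abs_moment:
  "gauss_moment j \<le> (\<integral>x. std_normal_density x * \<bar>x\<bar> ^ j \<partial>lborel)"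
proof -
  have "gauss_moment j = (\<integral>x. std_normal_density x * x ^ j \<partial>lborel)"
    using has_bochner_integral_gauss_moment[THEN has_bochner_integral_integral_eq] by simp
  also have "\<dots> \<le> (\<integral>x. std_normal_density x * \<bar>x\<bar> ^ j \<partial>lborel)"
    by (intro integral_mono integrable_std_normal_moment integrable_std_normal_moment_abs
        mult_left_mono) (auto simp flip: power_abs)
  finally show ?thesis .
qed

text \<open>The complex moments \<open>E (Z + iZ')\<^sup>N\<close> of independent standard Gaussians vanish for \<open>N > 0\<close>.\<close>

lemma gauss_moment_alternating_sum:
  "(\<Sum>j\<le>N. real (N choose j) * ((-1) ^ (j div 2) * gauss_moment j) * gauss_moment (N - j)) = of_bool (N = 0)"
proof (cases "even N")
  case False
  \<comment> \<open>For odd \<open>N\<close> one of \<open>j\<close> and \<open>N - j\<close> is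
    odd, and odd moments vanish.\<close>
  have "gauss_moment j = 0 \<or> gauss_moment (N - j) = 0" if "j \<le> N" for j
    using False that by (auto simp: gauss_moment_def)
  moreover have "N \<noteq> 0" using False by (cases N) auto
  ultimately show ?thesis by (intro trans[OF sum.neutral]) auto
next
  case True
  then obtain q where N: "N = 2 * q" by blast
  have "(\<Sum>j\<le>N. real (N choose j) * ((-1) ^ (j div 2) * gauss_moment j) * gauss_moment (N - j))
    = (\<Sum>j\<in>(\<lambda>l. 2 * l) ` {..q}. real (N choose j) * ((-1) ^ (j div 2) * gauss_moment j) * gauss_moment (N - j))"
    by (rule sum.mono_neutral_right) (auto simp: N gauss_moment_def elim!: evenE)
  \<comment> \<open>The factorials in the moments cancel against those in the binomial coefficient,
    leaving a constant times the expansion of \<open>(1 - 1)^q\<close>.\<close>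
  also have "\<dots> = (\<Sum>l\<le>q. fact N / (2 ^ q * fact q) * ((-1) ^ l * real (q choose l)))"
  proof (subst sum.reindex)
    show "inj_on (\<lambda>l. 2 * l) {..q}" by (auto simp: inj_on_def)
  next
    have "real (N choose (2 * l)) * ((-1) ^ l * gauss_moment (2 * l)) * gauss_moment (N - 2 * l)
      = fact N / (2 ^ q * fact q) * ((-1) ^ l * real (q choose l))" if "l \<le> q" for l
    proof -
      have e: "N - 2 * l = 2 * (q - l)" using N by simp
      have p: "(2::real) ^ q = 2 ^ l * 2 ^ (q - l)" using that by (simp flip: power_add)
      show ?thesis
        using that
        by (simp add: e gauss_moment_def binomial_fact[of l q] binomial_fact[of "2 * l" "2 * q"] p N
            flip: right_diff_distrib')
    qed
    then show "sum ((\<lambda>j. real (N choose j) * ((-1) ^ (j div 2) * gauss_moment j) * gauss_moment (N - j)) \<circ> (\<lambda>l. 2 * l)) {..q}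
      = (\<Sum>l\<le>q. fact N / (2 ^ q * fact q) * ((-1) ^ l * real (q choose l)))"
      by (intro sum.cong) auto
  qed
  also have "\<dots> = fact N / (2 ^ q * fact q) * (\<Sum>l\<le>q. (-1) ^ l * real (q choose l))"
    by (simp add: sum_distrib_left)
  also have "\<dots> = of_bool (N = 0)"
    using choose_alternating_sum[of q, where ?'a = real] by (cases "q = 0") (auto simp: N)
  finally show ?thesis .
qed

text \<open>Substituting \<open>v = x + s * u\<close> turns the integral into the expectation of
  \<open>(x + s Z)^k\<close> for a standard Gaussian Z, which is expanded binomially.\<close>

lemma has_bochner_integral_normal_power:
  assumes "s > 0"
  shows "has_bochner_integral lborel (\<lambda>v. normal_density x s v * v ^ k)
    (\<Sum>l\<le>k. real (k choose l) * x ^ (k - l) * s ^ l * gauss_moment l)"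
proof -
  have d: "normal_density x s (x + s * u) = std_normal_density u / s" for u
    using assms by (simp add: normal_density_def field_simps real_sqrt_mult)
  have "has_bochner_integral lborel
      (\<lambda>u. \<Sum>l\<le>k. (real (k choose l) * x ^ (k - l) * s ^ l / s) * (std_normal_density u * u ^ l))
      (\<Sum>l\<le>k. (real (k choose l) * x ^ (k - l) * s ^ l / s) * gauss_moment l)"
    by (intro has_bochner_integral_sum has_bochner_integral_mult_right
        has_bochner_integral_gauss_moment)
  also have "(\<lambda>u. \<Sum>l\<le>k. (real (k choose l) * x ^ (k - l) * s ^ l / s) * (std_normal_density u * u ^ l))
    = (\<lambda>u. normal_density x s (x + s * u) * (x + s * u) ^ k)"
  proof
    fix u
    have b: "(x + s * u) ^ k = (\<Sum>l\<le>k. real (k choose l) * (s * u) ^ l * x ^ (k - l))"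
      by (subst add.commute) (rule binomial_ring)
    show "(\<Sum>l\<le>k. (real (k choose l) * x ^ (k - l) * s ^ l / s) * (std_normal_density u * u ^ l))
      = normal_density x s (x + s * u) * (x + s * u) ^ k"
      unfolding d b sum_distrib_left by (intro sum.cong) (auto simp: power_mult_distrib)
  qed
  finally show ?thesis
    using assms
    by (subst lborel_has_bochner_integral_real_affine_iff[where c = s and t = x])
      (auto simp: sum_distrib_left field_simps)
qed

text \<open>This is \<open>E (v + i s Z) ^ k\<close> for a standard Gaussian \<open>Z\<close>, a rescaled Hermite polynomial.\<close>

definition heat_poly :: "real \<Rightarrow> nat \<Rightarrow> real \<Rightarrow> real" where
  "heat_poly s k v = (\<Sum>j\<le>k. real (k choose j) * s ^ j * ((-1) ^ (j div 2) * gauss_moment j) * v ^ (k - j))"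

text \<open>The smoothed polynomial is the expectation of \<open>(x + s (Z + i Z'))^k\<close> with
  independent standard Gaussians; every positive complex moment of \<open>Z + i Z'\<close> vanishes,
  so only \<open>x ^ k\<close> survives. This is the inversion of the heat flow on
  monomials.\<close>

lemma has_bochner_integral_heat_poly:
  assumes "s > 0"
  shows "has_bochner_integral lborel (\<lambda>v. normal_density x s v * heat_poly s k v) (x ^ k)"
proof -
  define c where "c j = (-1) ^ (j div 2) * gauss_moment j" for j
  define G where "G j l = real (k choose j) * s ^ j * c j *
      (real ((k - j) choose l) * x ^ (k - j - l) * s ^ l * gauss_moment l)" for j l
  have "has_bochner_integral lborel
    (\<lambda>v. \<Sum>j\<le>k. (real (k choose j) * s ^ j * c j) * (normal_density x s v * v ^ (k - j)))
    (\<Sum>j\<le>k. (real (k choose j) * s ^ j * c j) *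
      (\<Sum>l\<le>k - j. real ((k - j) choose l) * x ^ (k - j - l) * s ^ l * gauss_moment l))"
    by (intro has_bochner_integral_sum has_bochner_integral_mult_right
        has_bochner_integral_normal_power assms)
  also have "(\<lambda>v. \<Sum>j\<le>k. (real (k choose j) * s ^ j * c j) * (normal_density x s v * v ^ (k - j)))
    = (\<lambda>v. normal_density x s v * heat_poly s k v)"
    by (simp add: heat_poly_def c_def sum_distrib_left algebra_simps)
  also have "(\<Sum>j\<le>k. (real (k choose j) * s ^ j * c j) *
      (\<Sum>l\<le>k - j. real ((k - j) choose l) * x ^ (k - j - l) * s ^ l * gauss_moment l))
    = (\<Sum>j\<le>k. \<Sum>l\<le>k - j. G j l)"
    by (simp add: sum_distrib_left G_def)
  also have "\<dots> = (\<Sum>(j, l)\<in>(SIGMA j:{..k}. {..k - j}). G j l)"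
    by (simp add: sum.Sigma)
  also have "(SIGMA j:{..k}. {..k - j}) = {(j, l). j + l \<le> k}"
    by auto
  \<comment> \<open>Grouping by the total order \<open>N = j + l\<close> makes each inner sum an
    instance of \<open>gauss_moment_alternating_sum\<close>.\<close>
  also have "(\<Sum>(j, l)\<in>{(j, l). j + l \<le> k}. G j l) = (\<Sum>N\<le>k. \<Sum>j\<le>N. G j (N - j))"
    by (rule sum.triangle_reindex_eq)
  also have "\<dots> = (\<Sum>N\<le>k. real (k choose N) * x ^ (k - N) * s ^ N *
      (\<Sum>j\<le>N. real (N choose j) * c j * gauss_moment (N - j)))"
  proof (intro sum.cong refl, subst sum_distrib_left, intro sum.cong refl)
    fix N j assume "N \<in> {..k}" "j \<in> {..N}"
    then have jN: "j \<le> N" "N \<le> k" by auto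
    have "real (k choose j) * real ((k - j) choose (N - j)) = real (k choose N) * real (N choose j)"
      using choose_mult[OF jN] by (metis of_nat_mult)
    moreover have "s ^ N = s ^ j * s ^ (N - j)" "k - j - (N - j) = k - N"
      using jN by (simp_all flip: power_add)
    ultimately show "G j (N - j) = real (k choose N) * x ^ (k - N) * s ^ N *
        (real (N choose j) * c j * gauss_moment (N - j))"
      unfolding G_def by simp
  qed
  also have "\<dots> = (\<Sum>N\<le>k. if N = 0 then x ^ k else 0)"
    unfolding c_def gauss_moment_alternating_sum by (intro sum.cong) auto
  also have "\<dots> = x ^ k"
    by simp
  finally show ?thesis .
qed

text \<open>Taking absolute values termwise discards the signs that come from the imaginary unit, so
  the bound is the expectation of \<open>(\<bar>v\<bar> + s \<bar>Z\<bar>)^k\<close>.\<close>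

lemma abs_heat_poly_le:
  assumes "s \<ge> 0"
  shows "\<bar>heat_poly s k v\<bar> \<le> (\<integral>y. std_normal_density y * (\<bar>v\<bar> + s * \<bar>y\<bar>) ^ k \<partial>lborel)"
    and "integrable lborel (\<lambda>y. std_normal_density y * (\<bar>v\<bar> + s * \<bar>y\<bar>) ^ k)"
proof -
  have eq: "std_normal_density y * (\<bar>v\<bar> + s * \<bar>y\<bar>) ^ k
    = (\<Sum>j\<le>k. (real (k choose j) * s ^ j * \<bar>v\<bar> ^ (k - j)) * (std_normal_density y * \<bar>y\<bar> ^ j))" for y
    by (simp add: binomial_ring[of "s * \<bar>y\<bar>"] add.commute[of "\<bar>v\<bar>"] power_mult_distrib
        sum_distrib_left mult_ac)
  show "integrable lborel (\<lambda>y. std_normal_density y * (\<bar>v\<bar> + s * \<bar>y\<bar>) ^ k)"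
    unfolding eq
    by (intro Bochner_Integration.integrable_sum integrable_mult_right integrable_std_normal_moment_abs)
  have "\<bar>heat_poly s k v\<bar> \<le>
    (\<Sum>j\<le>k. \<bar>real (k choose j) * s ^ j * ((-1) ^ (j div 2) * gauss_moment j) * v ^ (k - j)\<bar>)"
    unfolding heat_poly_def by (rule sum_abs)
  also have "\<dots> = (\<Sum>j\<le>k. (real (k choose j) * s ^ j * \<bar>v\<bar> ^ (k - j)) * gauss_moment j)"
    using assms gauss_moment_nonneg by (simp add: abs_mult power_abs mult_ac)
  also have "\<dots> \<le> (\<Sum>j\<le>k. (real (k choose j) * s ^ j * \<bar>v\<bar> ^ (k - j)) *
      (\<integral>y. std_normal_density y * \<bar>y\<bar> ^ j \<partial>lborel))"
    using assms by (intro sum_mono mult_left_mono gauss_moment_le_abs_moment) auto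
  also have "\<dots> = (\<integral>y. std_normal_density y * (\<bar>v\<bar> + s * \<bar>y\<bar>) ^ k \<partial>lborel)"
    unfolding eq
    by (subst Bochner_Integration.integral_sum)
      (auto intro!: integrable_mult_right integrable_std_normal_moment_abs simp del: real_scaleR_def)
  finally show "\<bar>heat_poly s k v\<bar> \<le> (\<integral>y. std_normal_density y * (\<bar>v\<bar> + s * \<bar>y\<bar>) ^ k \<partial>lborel)" .
qed

section \<open>The probe function and its Gaussian smoothing\<close>

text \<open>Multiplying the weight by the density of mean \<open>\<mu>\<close> and deviation
  \<open>\<sigma>\<close> and completing the square gives
  \<open>exp (- \<mu>^2 / (4 \<sigma>^2))\<close> times the density of mean \<open>\<mu> / 2\<close>
  and deviation \<open>\<sigma> / sqrt 2\<close>. Hence the parameter of \<open>heat_poly\<close>,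
  the factor \<open>sqrt 2\<close>, and \<open>2 / \<epsilon>\<close>, which compensates the halved
  mean.\<close>

definition probe :: "real \<Rightarrow> real \<Rightarrow> real \<Rightarrow> real" where
  "probe \<sigma> \<epsilon> v = sqrt 2 * exp (- v\<^sup>2 / (2 * \<sigma>\<^sup>2)) *
     (\<Sum>k. sinc_coeff k * (2 / \<epsilon>) ^ k * heat_poly (\<sigma> / sqrt 2) k v)"

definition profile :: "real \<Rightarrow> real \<Rightarrow> real \<Rightarrow> real" where
  "profile \<sigma> \<epsilon> x = exp (- x\<^sup>2 / (4 * \<sigma>\<^sup>2)) * (\<Sum>k. sinc_coeff k * (x / \<epsilon>) ^ k)"

text \<open>With \<open>\<rho> ^ 3 = \<sigma> / \<epsilon>\<close>, the root and the square balance
  at \<open>t\<close> of order \<open>\<rho>\<close>, where both have order \<open>\<rho>^2\<close>: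
  this is the source of the exponent 2/3. Below \<open>16 * \<rho>\<close> the root is at most
  \<open>6 * \<rho>^2\<close>; above, it is absorbed by the square. The coefficient 3/16 lies below
  1/4, which keeps Gaussian integrals finite.\<close>

lemma sqrt_cube_mult_le:
  fixes \<rho> t :: real
  assumes "\<rho> \<ge> 0" and "t \<ge> 0"
  shows "8 * sqrt (2 * \<rho> ^ 3 * t) \<le> 48 * \<rho>\<^sup>2 + 3 / 16 * t\<^sup>2"
proof (cases "t \<le> 16 * \<rho>")
  case True
  have "2 * \<rho> ^ 3 * t \<le> 2 * \<rho> ^ 3 * (16 * \<rho>)"
    using True assms by (intro mult_left_mono) auto
  also have "\<dots> \<le> (6 * \<rho>\<^sup>2)\<^sup>2"
    using assms by (simp add: power2_eq_square power3_eq_cube)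
  finally have "sqrt (2 * \<rho> ^ 3 * t) \<le> 6 * \<rho>\<^sup>2"
    by (rule real_le_lsqrt[rotated]) simp
  moreover have "0 \<le> t\<^sup>2" by simp
  ultimately show ?thesis by linarith
next
  case False
  have "2 * \<rho> ^ 3 * t \<le> 2 * (t / 16) ^ 3 * t"
    using False assms by (intro mult_left_mono mult_right_mono power_mono) auto
  also have "\<dots> \<le> (3 / 128 * t\<^sup>2)\<^sup>2"
    using assms by (simp add: power2_eq_square power3_eq_cube)
  finally have "sqrt (2 * \<rho> ^ 3 * t) \<le> 3 / 128 * t\<^sup>2"
    by (rule real_le_lsqrt[rotated]) simp
  moreover have "0 \<le> \<rho>\<^sup>2" by simp
  ultimately show ?thesis by linarith
qed

text \<open>The extra factor halves the Gaussian exponent, so the variance doubles and the mass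
  becomes \<open>sqrt 2\<close>.\<close>

lemma has_bochner_integral_std_normal_exp_sq:
  "has_bochner_integral lborel (\<lambda>y. std_normal_density y * exp (y\<^sup>2 / 4)) (sqrt 2)"
proof -
  have "std_normal_density y * exp (y\<^sup>2 / 4) = sqrt 2 * normal_density 0 (sqrt 2) y" for y
    by (simp add: normal_density_def real_sqrt_mult field_simps flip: exp_add)
  then show ?thesis
    by (simp add: has_bochner_integral_iff)
qed

text \<open>Telescoping: for \<open>n \<ge> 1\<close> the term is at most
  \<open>1 / (n^2 - 1/4) = 2 / (2n - 1) - 2 / (2n + 1)\<close>. The induction hypothesis is an
  equality at \<open>N = 0\<close>.\<close>

lemma sum_inverse_one_plus_square_le:
  assumes "finite J"
  shows "(\<Sum>j\<in>J. 1 / (1 + (real j)\<^sup>2)) \<le> 3"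
proof -
  have *: "(\<Sum>j\<le>N. 1 / (1 + (real j)\<^sup>2)) \<le> 3 - 2 / (2 * real N + 1)" for N
  proof (induction N)
    case (Suc N)
    have "1 / (1 + (real (Suc N))\<^sup>2) \<le> 4 / ((2 * real N + 1) * (2 * real N + 3))"
      by (simp add: divide_le_eq pos_le_divide_eq add_pos_nonneg)
        (simp add: power2_eq_square algebra_simps)
    also have "\<dots> = 2 / (2 * real N + 1) - 2 / (2 * real (Suc N) + 1)"
      by (simp add: field_simps)
    finally show ?case using Suc by simp
  qed simp
  obtain N where "J \<subseteq> {..N}"
    using finite_nat_iff_bounded_le assms by blast
  then have "(\<Sum>j\<in>J. 1 / (1 + (real j)\<^sup>2)) \<le> (\<Sum>j\<le>N. 1 / (1 + (real j)\<^sup>2))"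
    by (intro sum_mono2) auto
  also have "\<dots> \<le> 3 - 2 / (2 * real N + 1)" by (rule *)
  also have "\<dots> \<le> 3" by simp
  finally show ?thesis .
qed

text \<open>Split the integers at the floor of \<open>x\<close>. On each side the distances to
  \<open>x\<close> dominate distinct natural numbers, so each side contributes at most 3, uniformly
  in \<open>x\<close>.\<close>

lemma sum_shifted_inverse_square_le:
  fixes x :: real and F :: "int set"
  assumes "finite F"
  shows "(\<Sum>n\<in>F. 1 / (1 + (x - of_int n)\<^sup>2)) \<le> 6"
proof -
  define F1 F2 where "F1 = F \<inter> {..\<lfloor>x\<rfloor>}" and "F2 = F \<inter> {\<lfloor>x\<rfloor><..}"
  have F: "F = F1 \<union> F2" "F1 \<inter> F2 = {}" "finite F1" "finite F2"
    using assms by (auto simp: F1_def F2_def)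
  have "(\<Sum>n\<in>F1. 1 / (1 + (x - of_int n)\<^sup>2)) \<le> (\<Sum>n\<in>F1. 1 / (1 + (real (nat (\<lfloor>x\<rfloor> - n)))\<^sup>2))"
  proof (intro sum_mono divide_left_mono add_left_mono power_mono mult_pos_pos)
    fix n assume "n \<in> F1"
    then have "real (nat (\<lfloor>x\<rfloor> - n)) = of_int \<lfloor>x\<rfloor> - of_int n" by (simp add: F1_def)
    then show "real (nat (\<lfloor>x\<rfloor> - n)) \<le> x - of_int n"
      using of_int_floor_le[of x] by linarith
  qed (auto simp: add_pos_nonneg)
  also have "\<dots> = (\<Sum>j\<in>(\<lambda>n. nat (\<lfloor>x\<rfloor> - n)) ` F1. 1 / (1 + (real j)\<^sup>2))"
    by (subst sum.reindex) (auto simp: inj_on_def F1_def)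
  also have "\<dots> \<le> 3" using F by (intro sum_inverse_one_plus_square_le) auto
  finally have 1: "(\<Sum>n\<in>F1. 1 / (1 + (x - of_int n)\<^sup>2)) \<le> 3" .
  \<comment> \<open>The first integer above \<open>x\<close> may be arbitrarily close to it, so the
    count on this side starts at 0 after subtracting 1.\<close>
  have "(\<Sum>n\<in>F2. 1 / (1 + (x - of_int n)\<^sup>2)) \<le> (\<Sum>n\<in>F2. 1 / (1 + (real (nat (n - \<lfloor>x\<rfloor> - 1)))\<^sup>2))"
  proof (intro sum_mono divide_left_mono add_left_mono mult_pos_pos)
    fix n assume "n \<in> F2"
    then have "real (nat (n - \<lfloor>x\<rfloor> - 1)) = of_int n - of_int \<lfloor>x\<rfloor> - 1" by (simp add: F2_def)
    then have "real (nat (n - \<lfloor>x\<rfloor> - 1)) \<le> of_int n - x"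
      using real_of_int_floor_add_one_ge[of x] by linarith
    then have "(real (nat (n - \<lfloor>x\<rfloor> - 1)))\<^sup>2 \<le> (of_int n - x)\<^sup>2"
      by (intro power_mono) auto
    then show "(real (nat (n - \<lfloor>x\<rfloor> - 1)))\<^sup>2 \<le> (x - of_int n)\<^sup>2"
      by (simp add: power2_commute)
  qed (auto simp: add_pos_nonneg)
  also have "\<dots> = (\<Sum>j\<in>(\<lambda>n. nat (n - \<lfloor>x\<rfloor> - 1)) ` F2. 1 / (1 + (real j)\<^sup>2))"
    by (subst sum.reindex) (auto simp: inj_on_def F2_def)
  also have "\<dots> \<le> 3" using F by (intro sum_inverse_one_plus_square_le) auto
  finally have "(\<Sum>n\<in>F2. 1 / (1 + (x - of_int n)\<^sup>2)) \<le> 3" .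
  with 1 show ?thesis using F by (simp add: sum.union_disjoint)
qed

section \<open>Size and Gaussian smoothing of the probe\<close>

context
  fixes \<sigma> \<epsilon> :: real
  assumes \<sigma>: "\<sigma> > 0" and \<epsilon>: "\<epsilon> > 0"
begin

text \<open>The bound on \<open>heat_poly\<close> moves the partial sum under a Gaussian
  expectation, where it is at most \<open>2 * exp (8 * sqrt (w y))\<close>. Subadditivity of the
  root separates \<open>v\<close> from \<open>y\<close>; the resulting quadratic term in
  \<open>y\<close> is integrable against the Gaussian.\<close>

lemma probe_partial_sum_le:
  "(\<Sum>k<n. \<bar>sinc_coeff k * (2 / \<epsilon>) ^ k * heat_poly (\<sigma> / sqrt 2) k v\<bar>)
     \<le> 3 * exp (96 * (\<sigma> / \<epsilon>) powr (2 / 3) + 3 / 16 * (v / \<sigma>)\<^sup>2)"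
proof -
  define s where "s = \<sigma> / sqrt 2"
  have s: "0 < s" "s \<le> \<sigma>" using \<sigma> by (auto simp: s_def field_simps)
  define \<rho> where "\<rho> = (\<sigma> / \<epsilon>) powr (1 / 3)"
  have \<rho>: "\<rho> \<ge> 0" "\<rho> ^ 3 = \<sigma> / \<epsilon>" "\<rho>\<^sup>2 = (\<sigma> / \<epsilon>) powr (2 / 3)"
    using \<sigma> \<epsilon> by (simp_all add: \<rho>_def powr_powr flip: powr_numeral)
  define w where "w y = 2 / \<epsilon> * (\<bar>v\<bar> + s * \<bar>y\<bar>)" for y :: real
  have w: "w y \<ge> 0" for y using s \<epsilon> by (simp add: w_def)
  have w_power: "w y ^ k = (2 / \<epsilon>) ^ k * (\<bar>v\<bar> + s * \<bar>y\<bar>) ^ k" for y k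
    by (simp only: w_def power_mult_distrib)
  \<comment> \<open>96 = 2 * 48: \<open>sqrt_cube_mult_le\<close> is used once for
    \<open>\<bar>v\<bar> / \<sigma>\<close> and once for \<open>\<bar>y\<bar>\<close>.\<close>
  define E where "E = 96 * \<rho>\<^sup>2 + 3 / 16 * (v / \<sigma>)\<^sup>2"
  have sqrt_w: "8 * sqrt (w y) \<le> E + y\<^sup>2 / 4" for y
  proof -
    have "w y \<le> 2 * \<rho> ^ 3 * (\<bar>v\<bar> / \<sigma>) + 2 * \<rho> ^ 3 * \<bar>y\<bar>"
      using \<sigma> \<epsilon> s mult_right_mono[OF s(2), of "\<bar>y\<bar>"] by (simp add: w_def \<rho> field_simps)
    then have "sqrt (w y) \<le> sqrt (2 * \<rho> ^ 3 * (\<bar>v\<bar> / \<sigma>) + 2 * \<rho> ^ 3 * \<bar>y\<bar>)"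
      by simp
    also have "\<dots> \<le> sqrt (2 * \<rho> ^ 3 * (\<bar>v\<bar> / \<sigma>)) + sqrt (2 * \<rho> ^ 3 * \<bar>y\<bar>)"
      using \<rho> \<sigma> \<epsilon> by (intro sqrt_add_le_add_sqrt) auto
    finally have "8 * sqrt (w y) \<le> 48 * \<rho>\<^sup>2 + 3 / 16 * (\<bar>v\<bar> / \<sigma>)\<^sup>2 + (48 * \<rho>\<^sup>2 + 3 / 16 * \<bar>y\<bar>\<^sup>2)"
      using sqrt_cube_mult_le[of \<rho> "\<bar>v\<bar> / \<sigma>"] sqrt_cube_mult_le[of \<rho> "\<bar>y\<bar>"] \<rho> \<sigma> by simp
    with zero_le_power2[of y] show ?thesis
      unfolding E_def power_divide power2_abs by linarith
  qed
  have int: "integrable lborel (\<lambda>y. std_normal_density y * w y ^ k)" for k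
    using integrable_mult_right[OF abs_heat_poly_le(2)[where s = s and k = k and v = v], of "(2 / \<epsilon>) ^ k"] s
    by (simp add: w_power mult_ac)
  have "(\<Sum>k<n. \<bar>sinc_coeff k * (2 / \<epsilon>) ^ k * heat_poly s k v\<bar>) \<le>
      (\<Sum>k<n. \<bar>sinc_coeff k\<bar> * (\<integral>y. std_normal_density y * w y ^ k \<partial>lborel))"
  proof (rule sum_mono)
    fix k
    have "\<bar>sinc_coeff k * (2 / \<epsilon>) ^ k * heat_poly s k v\<bar> = \<bar>sinc_coeff k\<bar> * ((2 / \<epsilon>) ^ k * \<bar>heat_poly s k v\<bar>)"
      using \<epsilon> by (simp add: abs_mult)
    also have "\<dots> \<le> \<bar>sinc_coeff k\<bar> * ((2 / \<epsilon>) ^ k * (\<integral>y. std_normal_density y * (\<bar>v\<bar> + s * \<bar>y\<bar>) ^ k \<partial>lborel))"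
      using s \<epsilon> by (intro mult_left_mono abs_heat_poly_le) auto
    also have "(2 / \<epsilon>) ^ k * (\<integral>y. std_normal_density y * (\<bar>v\<bar> + s * \<bar>y\<bar>) ^ k \<partial>lborel)
      = (\<integral>y. std_normal_density y * w y ^ k \<partial>lborel)"
      by (subst integral_mult_right_zero[symmetric])
        (simp only: w_power mult.left_commute)
    finally show "\<bar>sinc_coeff k * (2 / \<epsilon>) ^ k * heat_poly s k v\<bar> \<le>
        \<bar>sinc_coeff k\<bar> * (\<integral>y. std_normal_density y * w y ^ k \<partial>lborel)" .
  qed
  also have "\<dots> = (\<integral>y. (\<Sum>k<n. \<bar>sinc_coeff k\<bar> * (std_normal_density y * w y ^ k)) \<partial>lborel)"
    using int by (subst Bochner_Integration.integral_sum) auto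
  also have "\<dots> \<le> (\<integral>y. 2 * exp E * (std_normal_density y * exp (y\<^sup>2 / 4)) \<partial>lborel)"
  proof (rule integral_mono)
    show "integrable lborel (\<lambda>y. \<Sum>k<n. \<bar>sinc_coeff k\<bar> * (std_normal_density y * w y ^ k))"
      using int by (intro Bochner_Integration.integrable_sum integrable_mult_right) auto
    show "integrable lborel (\<lambda>y. 2 * exp E * (std_normal_density y * exp (y\<^sup>2 / 4)))"
      using has_bochner_integral_std_normal_exp_sq
      by (intro integrable_mult_right) (auto simp: has_bochner_integral_iff)
    fix y
    have "(\<Sum>k<n. \<bar>sinc_coeff k\<bar> * (std_normal_density y * w y ^ k))
      = std_normal_density y * (\<Sum>k<n. \<bar>sinc_coeff k\<bar> * w y ^ k)"
      by (simp add: sum_distrib_left mult_ac)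
    also have "\<dots> \<le> std_normal_density y * (2 * exp (8 * sqrt (w y)))"
      by (intro mult_left_mono sinc_coeff_sum_le w) auto
    also have "\<dots> \<le> std_normal_density y * (2 * exp (E + y\<^sup>2 / 4))"
      using sqrt_w[of y] by (intro mult_left_mono) auto
    finally show "(\<Sum>k<n. \<bar>sinc_coeff k\<bar> * (std_normal_density y * w y ^ k))
        \<le> 2 * exp E * (std_normal_density y * exp (y\<^sup>2 / 4))"
      by (simp add: exp_add mult_ac)
  qed
  also have "\<dots> = 2 * sqrt 2 * exp E"
    using has_bochner_integral_std_normal_exp_sq[THEN has_bochner_integral_integral_eq] by simp
  also have "\<dots> \<le> 3 * exp E"
  proof (rule mult_right_mono)
    have "sqrt 2 \<le> (3 / 2 :: real)"
      by (rule real_le_lsqrt) (auto simp: power2_eq_square)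
    then show "2 * sqrt 2 \<le> (3::real)" by simp
  qed simp
  finally show ?thesis unfolding s_def E_def \<rho> .
qed

lemma probe_summable:
  "summable (\<lambda>k. \<bar>sinc_coeff k * (2 / \<epsilon>) ^ k * heat_poly (\<sigma> / sqrt 2) k v\<bar>)"
  using probe_partial_sum_le by (intro summableI_nonneg_bounded) auto

text \<open>Of the Gaussian exponent 1/2 the series consumes 3/16. The remaining 5/16 is at least
  1/4, and \<open>3 * sqrt 2 \<le> 5\<close>.\<close>

lemma exp_gauss_weight_le:
  "sqrt 2 * exp (- v\<^sup>2 / (2 * \<sigma>\<^sup>2)) * (3 * exp (L + 3 / 16 * (v / \<sigma>)\<^sup>2))
     \<le> 5 * exp L * exp (- v\<^sup>2 / (4 * \<sigma>\<^sup>2))"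
proof -
  have "sqrt 2 * exp (- v\<^sup>2 / (2 * \<sigma>\<^sup>2)) * (3 * exp (L + 3 / 16 * (v / \<sigma>)\<^sup>2))
    = (sqrt 2 * 3) * exp (L - 5 / 16 * (v / \<sigma>)\<^sup>2)"
    using \<sigma> by (simp add: field_simps power_divide flip: exp_add)
  also have "\<dots> \<le> 5 * exp (L - 1 / 4 * (v / \<sigma>)\<^sup>2)"
  proof (rule mult_mono)
    have "sqrt 2 \<le> (5 / 3 :: real)"
      by (rule real_le_lsqrt) (auto simp: power2_eq_square)
    then show "sqrt 2 * 3 \<le> (5::real)" by simp
    show "exp (L - 5 / 16 * (v / \<sigma>)\<^sup>2) \<le> exp (L - 1 / 4 * (v / \<sigma>)\<^sup>2)"
      using zero_le_power2[of "v / \<sigma>"] by (simp del: zero_le_power2)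
  qed auto
  also have "\<dots> = 5 * exp L * exp (- v\<^sup>2 / (4 * \<sigma>\<^sup>2))"
    by (simp add: power_divide flip: exp_add)
  finally show ?thesis .
qed

lemma abs_probe_le:
  "\<bar>probe \<sigma> \<epsilon> v\<bar> \<le> 5 * exp (96 * (\<sigma> / \<epsilon>) powr (2 / 3)) * exp (- v\<^sup>2 / (4 * \<sigma>\<^sup>2))"
proof -
  have "\<bar>\<Sum>k. sinc_coeff k * (2 / \<epsilon>) ^ k * heat_poly (\<sigma> / sqrt 2) k v\<bar>
    \<le> (\<Sum>k. \<bar>sinc_coeff k * (2 / \<epsilon>) ^ k * heat_poly (\<sigma> / sqrt 2) k v\<bar>)"
    by (rule summable_rabs[OF probe_summable])
  also have "\<dots> \<le> 3 * exp (96 * (\<sigma> / \<epsilon>) powr (2 / 3) + 3 / 16 * (v / \<sigma>)\<^sup>2)"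
    by (rule suminf_le_const[OF probe_summable probe_partial_sum_le])
  finally have "\<bar>probe \<sigma> \<epsilon> v\<bar> \<le> sqrt 2 * exp (- v\<^sup>2 / (2 * \<sigma>\<^sup>2)) *
      (3 * exp (96 * (\<sigma> / \<epsilon>) powr (2 / 3) + 3 / 16 * (v / \<sigma>)\<^sup>2))"
    by (simp add: probe_def abs_mult)
  also note exp_gauss_weight_le
  finally show ?thesis .
qed

lemma borel_measurable_probe [measurable]: "probe \<sigma> \<epsilon> \<in> borel_measurable borel"
  unfolding probe_def[abs_def] heat_poly_def by measurable

text \<open>After completing the square, \<open>has_bochner_integral_heat_poly\<close> evaluates
  each term of the series; the rest is the exchange of series and integral.\<close>

lemma integral_probe:
  "(\<integral>v. normal_density \<mu> \<sigma> v * probe \<sigma> \<epsilon> v \<partial>lborel) = profile \<sigma> \<epsilon> \<mu>"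
proof -
  define s where "s = \<sigma> / sqrt 2"
  have s: "s > 0" using \<sigma> by (simp add: s_def)
  define c where "c k = sinc_coeff k * (2 / \<epsilon>) ^ k" for k
  define W where "W v = normal_density \<mu> \<sigma> v * (sqrt 2 * exp (- v\<^sup>2 / (2 * \<sigma>\<^sup>2)))" for v
  have W0: "W v \<ge> 0" for v by (simp add: W_def)
  have W: "W v = exp (- \<mu>\<^sup>2 / (4 * \<sigma>\<^sup>2)) * normal_density (\<mu> / 2) s v" for v
  proof -
    have "- (v - \<mu>)\<^sup>2 / (2 * \<sigma>\<^sup>2) + - v\<^sup>2 / (2 * \<sigma>\<^sup>2) = - \<mu>\<^sup>2 / (4 * \<sigma>\<^sup>2) + - (v - \<mu> / 2)\<^sup>2 / (2 * s\<^sup>2)"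
      using \<sigma> by (simp add: s_def power_divide field_simps power2_eq_square)
    then show ?thesis
      using \<sigma> s unfolding W_def normal_density_def
      by (simp add: mult_exp_exp real_sqrt_mult s_def power_divide)
  qed
  have hb: "has_bochner_integral lborel (\<lambda>v. W v * (c k * heat_poly s k v))
      (exp (- \<mu>\<^sup>2 / (4 * \<sigma>\<^sup>2)) * (sinc_coeff k * (\<mu> / \<epsilon>) ^ k))" for k
  proof -
    have "has_bochner_integral lborel
        (\<lambda>v. (exp (- \<mu>\<^sup>2 / (4 * \<sigma>\<^sup>2)) * c k) * (normal_density (\<mu> / 2) s v * heat_poly s k v))
        ((exp (- \<mu>\<^sup>2 / (4 * \<sigma>\<^sup>2)) * c k) * (\<mu> / 2) ^ k)"
      by (intro has_bochner_integral_mult_right has_bochner_integral_heat_poly s)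
    then show ?thesis
      using \<epsilon> by (simp add: W c_def power_divide power_mult_distrib mult_ac)
  qed
  define L where "L = 96 * (\<sigma> / \<epsilon>) powr (2 / 3)"
  \<comment> \<open>An integrable bound uniform in \<open>n\<close> supplies both pointwise absolute
    summability and summability of the integrated norms, as \<open>sums_integral\<close>
    requires.\<close>
  have part: "(\<Sum>k<n. \<bar>W v * (c k * heat_poly s k v)\<bar>) \<le> 5 * exp L * normal_density \<mu> \<sigma> v" for n v
  proof -
    have "(\<Sum>k<n. \<bar>W v * (c k * heat_poly s k v)\<bar>) = W v * (\<Sum>k<n. \<bar>c k * heat_poly s k v\<bar>)"
      using W0 by (simp add: sum_distrib_left abs_mult)
    also have "\<dots> \<le> W v * (3 * exp (L + 3 / 16 * (v / \<sigma>)\<^sup>2))"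
      unfolding c_def s_def L_def by (intro mult_left_mono probe_partial_sum_le W0)
    also have "\<dots> \<le> normal_density \<mu> \<sigma> v * (5 * exp L * exp (- v\<^sup>2 / (4 * \<sigma>\<^sup>2)))"
      unfolding W_def using exp_gauss_weight_le[of v L]
      by (subst mult.assoc) (intro mult_left_mono, auto)
    also have "\<dots> \<le> normal_density \<mu> \<sigma> v * (5 * exp L * 1)"
      by (intro mult_left_mono) auto
    finally show ?thesis by (simp add: mult_ac)
  qed
  have sm: "summable (\<lambda>k. norm (W v * (c k * heat_poly s k v)))" for v
    using part by (intro summableI_nonneg_bounded[where x = "5 * exp L * normal_density \<mu> \<sigma> v"]) auto
  have int: "integrable lborel (\<lambda>v. W v * (c k * heat_poly s k v))" for k
    using hb by (auto simp: has_bochner_integral_iff)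
  have smi: "summable (\<lambda>k. \<integral>v. norm (W v * (c k * heat_poly s k v)) \<partial>lborel)"
  proof (rule summableI_nonneg_bounded)
    fix n
    have "(\<Sum>k<n. \<integral>v. norm (W v * (c k * heat_poly s k v)) \<partial>lborel)
      = (\<integral>v. (\<Sum>k<n. norm (W v * (c k * heat_poly s k v))) \<partial>lborel)"
      using int by (subst Bochner_Integration.integral_sum) (auto intro!: integrable_norm simp del: real_norm_def)
    also have "\<dots> \<le> (\<integral>v. 5 * exp L * normal_density \<mu> \<sigma> v \<partial>lborel)"
      using int part \<sigma> by (intro integral_mono Bochner_Integration.integrable_sum integrable_norm) auto
    finally show "(\<Sum>k<n. \<integral>v. norm (W v * (c k * heat_poly s k v)) \<partial>lborel) \<le>
      (\<integral>v. 5 * exp L * normal_density \<mu> \<sigma> v \<partial>lborel)" .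
  qed auto
  have "(\<integral>v. normal_density \<mu> \<sigma> v * probe \<sigma> \<epsilon> v \<partial>lborel) = (\<integral>v. (\<Sum>k. W v * (c k * heat_poly s k v)) \<partial>lborel)"
    using probe_summable[THEN summable_rabs_cancel]
    by (subst suminf_mult) (auto simp: probe_def W_def c_def s_def mult_ac intro!: Bochner_Integration.integral_cong)
  also have "(\<lambda>k. \<integral>v. W v * (c k * heat_poly s k v) \<partial>lborel) sums \<dots>"
    using int sm smi by (intro sums_integral) auto
  finally have *: "(\<lambda>k. exp (- \<mu>\<^sup>2 / (4 * \<sigma>\<^sup>2)) * (sinc_coeff k * (\<mu> / \<epsilon>) ^ k)) sums
      (\<integral>v. normal_density \<mu> \<sigma> v * probe \<sigma> \<epsilon> v \<partial>lborel)"
    using hb[THEN has_bochner_integral_integral_eq] by simp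
  \<comment> \<open>Cancelling the exponential also yields convergence of the series at negative
    \<open>\<mu> / \<epsilon>\<close>, outside the scope of \<open>sinc_coeff_sums\<close>.\<close>
  then have "(\<lambda>k. (sinc_coeff k * (\<mu> / \<epsilon>) ^ k)) sums
      ((\<integral>v. normal_density \<mu> \<sigma> v * probe \<sigma> \<epsilon> v \<partial>lborel) / exp (- \<mu>\<^sup>2 / (4 * \<sigma>\<^sup>2)))"
    by (subst sums_mult_iff[where c = "exp (- \<mu>\<^sup>2 / (4 * \<sigma>\<^sup>2))", symmetric]) auto
  then show ?thesis by (simp add: profile_def sums_unique[symmetric])
qed

lemma profile_0: "profile \<sigma> \<epsilon> 0 = 1"
  by (simp add: profile_def powser_zero)

lemma abs_profile_le:
  assumes "x > 0"
  shows "\<bar>profile \<sigma> \<epsilon> (\<epsilon> * x)\<bar> \<le> 1 / (16 * x\<^sup>2)"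
proof -
  have "(\<Sum>k. sinc_coeff k * x ^ k) = sin (2 * sqrt x) ^ 4 / (16 * x\<^sup>2)"
    using sinc_coeff_sums[OF assms] by (simp add: sums_unique[symmetric])
  then have "\<bar>profile \<sigma> \<epsilon> (\<epsilon> * x)\<bar> = exp (- (\<epsilon> * x)\<^sup>2 / (4 * \<sigma>\<^sup>2)) * (sin (2 * sqrt x) ^ 4 / (16 * x\<^sup>2))"
    using \<epsilon> by (simp add: profile_def abs_mult)
  also have "\<dots> \<le> 1 * (1 / (16 * x\<^sup>2))"
    using power_le_one[of "\<bar>sin (2 * sqrt x)\<bar>" 4]
    by (intro mult_mono divide_right_mono) auto
  finally show ?thesis by simp
qed

text \<open>This pointwise bound controls all translates simultaneously. The Gaussian decay is
  weakened to an inverse square through \<open>1 + u \<le> exp u\<close>, which makes the lattice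
  sum at most 6; the price \<open>1 + 2 * r^2\<close> is absorbed by raising 192 to 195 in the
  exponent.\<close>

lemma sum_probe_square_le:
  assumes "finite F"
  shows "(\<Sum>n\<in>F. (probe \<sigma> \<epsilon> (x - \<epsilon> * of_int n))\<^sup>2) \<le> 300 * exp (195 * (\<sigma> / \<epsilon>) powr (2 / 3))"
proof -
  define r where "r = \<sigma> / \<epsilon>"
  have r: "r > 0" using \<sigma> \<epsilon> by (simp add: r_def)
  define K where "K = 25 * exp (192 * r powr (2 / 3)) * (1 + 2 * r\<^sup>2)"
  have "(probe \<sigma> \<epsilon> (x - \<epsilon> * of_int n))\<^sup>2 \<le> K * (1 / (1 + (x / \<epsilon> - of_int n)\<^sup>2))" for n
  proof -
    define v where "v = x - \<epsilon> * of_int n"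
    define w where "w = (x / \<epsilon> - of_int n)\<^sup>2"
    have w: "w \<ge> 0" "v\<^sup>2 / (2 * \<sigma>\<^sup>2) = w / (2 * r\<^sup>2)"
      using \<epsilon> \<sigma> by (auto simp: w_def v_def r_def power_divide field_simps)
    have "(probe \<sigma> \<epsilon> v)\<^sup>2 \<le> (5 * exp (96 * r powr (2 / 3)) * exp (- v\<^sup>2 / (4 * \<sigma>\<^sup>2)))\<^sup>2"
      using abs_probe_le[of v] unfolding r_def
      by (metis abs_ge_zero power2_abs power_mono)
    also have "\<dots> = 25 * exp (192 * r powr (2 / 3)) * exp (- (v\<^sup>2 / (2 * \<sigma>\<^sup>2)))"
      by (simp add: power_mult_distrib flip: exp_double)
    also have "exp (- (v\<^sup>2 / (2 * \<sigma>\<^sup>2))) = 1 / exp (w / (2 * r\<^sup>2))"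
      by (simp add: w exp_minus inverse_eq_divide)
    also have "1 / exp (w / (2 * r\<^sup>2)) \<le> 1 / (1 + w / (2 * r\<^sup>2))"
      using w(1) by (intro divide_left_mono exp_ge_add_one_self mult_pos_pos add_pos_nonneg) auto
    also have "\<dots> \<le> (1 + 2 * r\<^sup>2) * (1 / (1 + w))"
    proof -
      have "1 + w \<le> (1 + 2 * r\<^sup>2) * (1 + w / (2 * r\<^sup>2))"
        using r w(1) by (simp add: field_simps)
      then show ?thesis using w(1) r
        by (simp add: divide_le_eq pos_le_divide_eq add_pos_nonneg mult_ac)
    qed
    finally show ?thesis
      by (simp add: v_def w_def K_def mult_ac)
  qed
  then have "(\<Sum>n\<in>F. (probe \<sigma> \<epsilon> (x - \<epsilon> * of_int n))\<^sup>2) \<le> (\<Sum>n\<in>F. K * (1 / (1 + (x / \<epsilon> - of_int n)\<^sup>2)))"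
    by (intro sum_mono)
  also have "\<dots> = K * (\<Sum>n\<in>F. 1 / (1 + (x / \<epsilon> - of_int n)\<^sup>2))"
    by (simp only: sum_distrib_left)
  also have "\<dots> \<le> K * 6"
    by (intro mult_left_mono sum_shifted_inverse_square_le assms) (auto simp: K_def add_nonneg_nonneg)
  also have "\<dots> = 150 * exp (192 * r powr (2 / 3)) * (1 + 2 * r\<^sup>2)"
    by (simp add: K_def)
  also have "\<dots> \<le> 150 * exp (192 * r powr (2 / 3)) * (2 * exp (3 * r powr (2 / 3)))"
  proof -
    define t where "t = r powr (2 / 3)"
    have t: "t \<ge> 0" "t ^ 3 = r\<^sup>2" using r by (simp_all add: t_def powr_powr flip: powr_numeral)
    \<comment> \<open>Since \<open>t ^ 3 = r^2\<close>, the terms of index 0 and 3 of the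
      exponential series suffice.\<close>
    have "(\<Sum>i\<in>{0, 3}. (3 * t) ^ i / fact i) \<le> (\<Sum>i. (3 * t) ^ i / fact i)"
      using summable_exp_generic[of "3 * t"] t
      by (intro sum_le_suminf) (auto simp: field_simps)
    also have "\<dots> = exp (3 * t)"
      by (simp add: exp_def field_simps)
    finally have "1 + 27 / 6 * r\<^sup>2 \<le> exp (3 * t)"
      using t by (simp add: eval_nat_numeral power_mult_distrib algebra_simps)
    then have "1 + 2 * r\<^sup>2 \<le> 2 * exp (3 * t)" using zero_le_power2[of r] exp_ge_zero[of "3 * t"] by linarith
    then show ?thesis by (simp add: t_def)
  qed
  also have "\<dots> = 300 * exp (195 * r powr (2 / 3))"
    by (simp flip: exp_add)
  finally show ?thesis by (simp add: r_def)
qed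

end

section \<open>Empirical means\<close>

lemma integral_PiM_sum_square:
  fixes G :: "'a \<Rightarrow> real"
  assumes "prob_space M" and [measurable]: "G \<in> borel_measurable M"
    and bnd: "\<And>x. \<bar>G x\<bar> \<le> K" and mean: "(\<integral>x. G x \<partial>M) = 0"
  shows "(\<integral>x. (\<Sum>i<m. G (x i))\<^sup>2 \<partial>(\<Pi>\<^sub>M i\<in>{..<m}. M)) = real m * (\<integral>x. (G x)\<^sup>2 \<partial>M)"
proof -
  interpret M: prob_space M by fact
  interpret P: product_prob_space "\<lambda>_. M" "{..<m}" by unfold_locales
  \<comment> \<open>Writes \<open>G (x i) * G (x j)\<close> as a product over all coordinates, so
    that the integral factorises; for \<open>i = j\<close> coordinate \<open>i\<close> carries
    \<open>G^2\<close>.\<close>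
  define F where "F i j l y = (if l = i then G y else 1) * (if l = j then G y else 1)" for i j l :: nat and y
  have GG: "\<bar>G x * G x\<bar> \<le> K * K" for x
    unfolding abs_mult by (intro mult_mono bnd order_trans[OF abs_ge_zero bnd]) auto
  have intG: "integrable M G" and intG2: "integrable M (\<lambda>x. G x * G x)"
    using bnd GG by (auto intro!: M.integrable_const_bound[of G K] M.integrable_const_bound[of "\<lambda>x. G x * G x" "K * K"])
  then have intF: "integrable M (F i j l)" for i j l
    by (cases "l = i"; cases "l = j") (auto simp: F_def[abs_def])
  have F: "(\<Prod>l<m. F i j l (x l)) = G (x i) * G (x j)" if "i < m" "j < m" for i j and x :: "nat \<Rightarrow> 'a"
    using that by (simp add: F_def prod.distrib prod.delta)
  have intP: "integrable (\<Pi>\<^sub>M i\<in>{..<m}. M) (\<lambda>x. G (x i) * G (x j))" if "i < m" "j < m" for i j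
    using P.product_integrable_prod[of "{..<m}" "F i j"] intF that by (simp add: F cong: integrable_cong)
  have one: "(\<integral>x. G (x i) * G (x j) \<partial>(\<Pi>\<^sub>M i\<in>{..<m}. M)) = (if i = j then \<integral>x. (G x)\<^sup>2 \<partial>M else 0)"
    if "i < m" "j < m" for i j
  proof -
    have "(\<integral>x. G (x i) * G (x j) \<partial>(\<Pi>\<^sub>M i\<in>{..<m}. M)) = (\<Prod>l<m. \<integral>y. F i j l y \<partial>M)"
      using P.product_integral_prod[of "{..<m}" "F i j"] intF that by (simp add: F)
    also have "\<dots> = (if i = j then \<integral>x. (G x)\<^sup>2 \<partial>M else 0)"
    proof (cases "i = j")
      case True
      have "(\<Prod>l<m. \<integral>y. F i j l y \<partial>M) = (\<Prod>l<m. if l = i then \<integral>x. (G x)\<^sup>2 \<partial>M else 1)"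
        using True by (intro prod.cong) (auto simp: F_def power2_eq_square M.prob_space)
      with True that show ?thesis by (simp add: prod.delta)
    next
      case False
      then have "(\<integral>y. F i j i y \<partial>M) = 0" using mean by (simp add: F_def)
      with False that show ?thesis by (auto simp: prod_zero_iff)
    qed
    finally show ?thesis .
  qed
  have "(\<integral>x. (\<Sum>i<m. G (x i))\<^sup>2 \<partial>(\<Pi>\<^sub>M i\<in>{..<m}. M))
    = (\<integral>x. (\<Sum>i<m. \<Sum>j<m. G (x i) * G (x j)) \<partial>(\<Pi>\<^sub>M i\<in>{..<m}. M))"
    by (simp add: power2_eq_square sum_product)
  also have "\<dots> = (\<Sum>i<m. \<Sum>j<m. \<integral>x. G (x i) * G (x j) \<partial>(\<Pi>\<^sub>M i\<in>{..<m}. M))"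
    using intP by (subst Bochner_Integration.integral_sum)
      (auto intro!: Bochner_Integration.integrable_sum Bochner_Integration.integral_sum sum.cong)
  also have "\<dots> = (\<Sum>i<m. \<Sum>j<m. if i = j then \<integral>x. (G x)\<^sup>2 \<partial>M else 0)"
    by (simp add: one)
  also have "\<dots> = real m * (\<integral>x. (G x)\<^sup>2 \<partial>M)"
    by simp
  finally show ?thesis .
qed

text \<open>Chebyshev's inequality, with the variance enlarged to the second moment because only
  sums of \<open>(h n)^2\<close> are controlled later.\<close>

lemma iid_samples_deviation:
  fixes h :: "real \<Rightarrow> real"
  assumes "prob_space M" and "sets M = sets borel" and [measurable]: "h \<in> borel_measurable borel"
    and bnd: "\<And>x. \<bar>h x\<bar> \<le> K" and \<eta>: "\<eta> > 0" and m: "m > 0"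
  shows "measure (iid_samples m M)
      {x \<in> space (iid_samples m M). \<bar>(\<Sum>i<m. h (x i)) / real m - (\<integral>y. h y \<partial>M)\<bar> \<ge> \<eta>}
    \<le> (\<integral>y. (h y)\<^sup>2 \<partial>M) / (real m * \<eta>\<^sup>2)"
proof -
  interpret M: prob_space M by fact
  interpret P: prob_space "iid_samples m M"
    unfolding iid_samples_def by (intro prob_space_PiM M.prob_space_axioms)
  note [measurable_cong] = assms(2)
  define a where "a = (\<integral>y. h y \<partial>M)"
  define G where "G y = h y - a" for y
  have [measurable]: "G \<in> borel_measurable borel" by (simp add: G_def[abs_def])
  have inth: "integrable M h"
    using bnd by (intro M.integrable_const_bound[of h K]) auto
  have inth2: "integrable M (\<lambda>y. (h y)\<^sup>2)"
  proof (intro M.integrable_const_bound[of _ "K\<^sup>2"] AE_I2)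
    fix y show "norm ((h y)\<^sup>2) \<le> K\<^sup>2"
      using power_mono[OF bnd[of y], of 2] by simp
  qed auto
  have bG: "\<bar>G y\<bar> \<le> K + \<bar>a\<bar>" for y
    using bnd[of y] by (simp add: G_def)
  have "(\<Sum>i<m. G (x i)) = (\<Sum>i<m. h (x i)) - real m * a" for x :: "nat \<Rightarrow> real"
    by (simp add: G_def sum_subtractf)
  then have "(\<Sum>i<m. h (x i)) / real m - a = (\<Sum>i<m. G (x i)) / real m" for x :: "nat \<Rightarrow> real"
    using m by (simp add: field_simps)
  then have "\<bar>(\<Sum>i<m. h (x i)) / real m - a\<bar> \<ge> \<eta> \<longleftrightarrow> \<bar>real m * \<eta>\<bar> \<le> \<bar>\<Sum>i<m. G (x i)\<bar>" for x :: "nat \<Rightarrow> real"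
    using m \<eta> by (simp add: abs_mult field_simps)
  then have iff: "\<bar>(\<Sum>i<m. h (x i)) / real m - a\<bar> \<ge> \<eta> \<longleftrightarrow> (\<Sum>i<m. G (x i))\<^sup>2 \<ge> (real m * \<eta>)\<^sup>2" for x :: "nat \<Rightarrow> real"
    by (simp only: abs_le_square_iff)
  have "measure (iid_samples m M) {x \<in> space (iid_samples m M). (\<Sum>i<m. G (x i))\<^sup>2 \<ge> (real m * \<eta>)\<^sup>2}
    \<le> (\<integral>x. (\<Sum>i<m. G (x i))\<^sup>2 \<partial>(iid_samples m M)) / (real m * \<eta>)\<^sup>2"
  proof (rule integral_Markov_inequality_measure[where A = "{}"])
    show "integrable (iid_samples m M) (\<lambda>x. (\<Sum>i<m. G (x i))\<^sup>2)"
    proof (rule P.integrable_const_bound[of _ "(real m * (K + \<bar>a\<bar>))\<^sup>2"])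
      show "(\<lambda>x. (\<Sum>i<m. G (x i))\<^sup>2) \<in> borel_measurable (iid_samples m M)"
        unfolding iid_samples_def by measurable
      have "\<bar>\<Sum>i<m. G (x i)\<bar> \<le> real m * (K + \<bar>a\<bar>)" for x :: "nat \<Rightarrow> real"
        using sum_mono[of "{..<m}" "\<lambda>i. \<bar>G (x i)\<bar>" "\<lambda>_. K + \<bar>a\<bar>"] bG
        by (intro order_trans[OF sum_abs]) simp
      from power_mono[OF this, where n = 2] show "AE x in iid_samples m M. norm ((\<Sum>i<m. G (x i))\<^sup>2) \<le> (real m * (K + \<bar>a\<bar>))\<^sup>2"
        by simp
    qed
  qed (use m \<eta> in auto)
  also have "(\<integral>x. (\<Sum>i<m. G (x i))\<^sup>2 \<partial>(iid_samples m M)) = real m * (\<integral>y. (G y)\<^sup>2 \<partial>M)"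
    unfolding iid_samples_def
    using inth by (intro integral_PiM_sum_square[where K = "K + \<bar>a\<bar>"] M.prob_space_axioms bG)
      (auto simp: G_def a_def M.prob_space)
  also have "(\<integral>y. (G y)\<^sup>2 \<partial>M) = (\<integral>y. (h y)\<^sup>2 \<partial>M) - a\<^sup>2"
    unfolding G_def a_def by (rule M.variance_eq[OF inth inth2])
  also have "real m * ((\<integral>y. (h y)\<^sup>2 \<partial>M) - a\<^sup>2) / (real m * \<eta>)\<^sup>2 \<le> real m * (\<integral>y. (h y)\<^sup>2 \<partial>M) / (real m * \<eta>)\<^sup>2"
    by (intro divide_right_mono mult_left_mono) auto
  also have "\<dots> = (\<integral>y. (h y)\<^sup>2 \<partial>M) / (real m * \<eta>\<^sup>2)"
    using m by (simp add: power2_eq_square)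
  finally show ?thesis
    unfolding a_def[symmetric] iff .
qed

text \<open>A union bound over infinitely many functions: the pointwise bound on the sum of squares
  makes the Chebyshev failure bounds sum to at most \<open>B / (m * \<eta>^2)\<close>.\<close>

lemma iid_samples_uniform_deviation:
  fixes h :: "nat \<Rightarrow> real \<Rightarrow> real"
  assumes "prob_space M" and "sets M = sets borel" and [measurable]: "\<And>n. h n \<in> borel_measurable borel"
    and bnd: "\<And>N x. (\<Sum>n<N. (h n x)\<^sup>2) \<le> B" and \<eta>: "\<eta> > 0" and m: "m > 0"
  shows "measure (iid_samples m M)
      {x \<in> space (iid_samples m M). \<forall>n. \<bar>(\<Sum>i<m. h n (x i)) / real m - (\<integral>y. h n y \<partial>M)\<bar> < \<eta>}
    \<ge> 1 - B / (real m * \<eta>\<^sup>2)"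
proof -
  interpret M: prob_space M by fact
  interpret P: prob_space "iid_samples m M"
    unfolding iid_samples_def by (intro prob_space_PiM M.prob_space_axioms)
  note [measurable_cong] = assms(2)
  define bad where "bad n = {x \<in> space (iid_samples m M).
    \<bar>(\<Sum>i<m. h n (x i)) / real m - (\<integral>y. h n y \<partial>M)\<bar> \<ge> \<eta>}" for n
  have bad_sets: "bad n \<in> sets (iid_samples m M)" for n
    unfolding bad_def iid_samples_def by measurable
  have h2: "(h n x)\<^sup>2 \<le> B" for n x
    using bnd[where N = "Suc n" and x = x] sum_nonneg[of "{..<n}" "\<lambda>n. (h n x)\<^sup>2"] by simp
  have hb: "\<bar>h n x\<bar> \<le> sqrt B" for n x
    using real_sqrt_le_mono[OF h2[of n x]] by simp
  have inth2: "integrable M (\<lambda>y. (h n y)\<^sup>2)" for n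
    using h2 by (intro M.integrable_const_bound[of _ B]) auto
  have part: "(\<Sum>n<N. measure (iid_samples m M) (bad n)) \<le> B / (real m * \<eta>\<^sup>2)" for N
  proof -
    have "(\<Sum>n<N. measure (iid_samples m M) (bad n)) \<le> (\<Sum>n<N. (\<integral>y. (h n y)\<^sup>2 \<partial>M) / (real m * \<eta>\<^sup>2))"
      unfolding bad_def by (intro sum_mono iid_samples_deviation[where K = "sqrt B"] assms hb)
    also have "\<dots> = (\<integral>y. (\<Sum>n<N. (h n y)\<^sup>2) \<partial>M) / (real m * \<eta>\<^sup>2)"
      using inth2 by (simp add: sum_divide_distrib)
    also have "\<dots> \<le> (\<integral>y. B \<partial>M) / (real m * \<eta>\<^sup>2)"
      using inth2 bnd by (intro divide_right_mono integral_mono) auto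
    finally show ?thesis by (simp add: M.prob_space)
  qed
  then have sm: "summable (\<lambda>n. measure (iid_samples m M) (bad n))"
    by (intro summableI_nonneg_bounded) auto
  have "measure (iid_samples m M) (\<Union>n. bad n) \<le> (\<Sum>n. measure (iid_samples m M) (bad n))"
    using bad_sets sm by (intro P.finite_measure_subadditive_countably) auto
  also have "\<dots> \<le> B / (real m * \<eta>\<^sup>2)"
    by (intro suminf_le_const sm part)
  finally have "measure (iid_samples m M) (space (iid_samples m M) - (\<Union>n. bad n)) \<ge> 1 - B / (real m * \<eta>\<^sup>2)"
    using bad_sets by (subst P.prob_compl) auto
  also have "space (iid_samples m M) - (\<Union>n. bad n) = {x \<in> space (iid_samples m M).
      \<forall>n. \<bar>(\<Sum>i<m. h n (x i)) / real m - (\<integral>y. h n y \<partial>M)\<bar> < \<eta>}"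
    by (auto simp: bad_def simp flip: not_le)
  finally show ?thesis .
qed

section \<open>Expectations under the mixture\<close>

lemma integral_gaussian_mixture:
  fixes h :: "real \<Rightarrow> real"
  assumes [measurable]: "h \<in> borel_measurable borel" and bnd: "\<And>x. \<bar>h x\<bar> \<le> K" and \<sigma>: "\<sigma> > 0"
  shows "(\<integral>x. h x \<partial>(gaussian_mixture k \<mu> \<sigma>)) = (\<Sum>i<k. \<integral>x. normal_density (\<mu> i) \<sigma> x * h x \<partial>lborel) / real k"
proof -
  have int: "integrable lborel (\<lambda>x. normal_density a \<sigma> x * h x)" for a
  proof (rule Bochner_Integration.integrable_bound)
    show "integrable lborel (\<lambda>x. K * normal_density a \<sigma> x)" using \<sigma> by simp
    show "AE x in lborel. norm (normal_density a \<sigma> x * h x) \<le> norm (K * normal_density a \<sigma> x)"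
    proof (rule AE_I2)
      fix x
      have "\<bar>h x\<bar> * normal_density a \<sigma> x \<le> \<bar>K\<bar> * normal_density a \<sigma> x"
        using bnd[of x] by (intro mult_right_mono) auto
      then show "norm (normal_density a \<sigma> x * h x) \<le> norm (K * normal_density a \<sigma> x)"
        by (simp add: abs_mult mult_ac)
    qed
  qed measurable
  have "(\<integral>x. h x \<partial>(gaussian_mixture k \<mu> \<sigma>))
    = (\<integral>x. ((1 / real k) * (\<Sum>i<k. normal_density (\<mu> i) \<sigma> x)) *\<^sub>R h x \<partial>lborel)"
    unfolding gaussian_mixture_def by (intro integral_density) (auto intro!: sum_nonneg divide_nonneg_nonneg)
  also have "\<dots> = (\<integral>x. (1 / real k) * (\<Sum>i<k. normal_density (\<mu> i) \<sigma> x * h x) \<partial>lborel)"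
    by (simp add: sum_distrib_right)
  also have "\<dots> = (1 / real k) * (\<Sum>i<k. \<integral>x. normal_density (\<mu> i) \<sigma> x * h x \<partial>lborel)"
    using int by (subst integral_mult_right_zero, subst Bochner_Integration.integral_sum) auto
  finally show ?thesis by simp
qed

lemma integral_shifted_probe:
  assumes "\<sigma> > 0" and "\<epsilon> > 0"
  shows "(\<integral>x. normal_density \<mu> \<sigma> x * probe \<sigma> \<epsilon> (x - a) \<partial>lborel) = profile \<sigma> \<epsilon> (\<mu> - a)"
proof -
  have "(\<integral>x. normal_density \<mu> \<sigma> x * probe \<sigma> \<epsilon> (x - a) \<partial>lborel)
    = (\<integral>x. normal_density (\<mu> - a) \<sigma> x * probe \<sigma> \<epsilon> x \<partial>lborel)"
    by (subst lborel_integral_real_affine[where c = 1 and t = a])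
      (simp_all add: normal_density_def algebra_simps)
  also have "\<dots> = profile \<sigma> \<epsilon> (\<mu> - a)"
    using assms by (rule integral_probe)
  finally show ?thesis .
qed

section \<open>Separation of hypotheses\<close>

text \<open>Common points cancel. The point \<open>p\<close> contributes 1, and all other points of
  the symmetric difference lie to its right at distinct positive integer distances, so they
  contribute at most 3/8 in absolute value.\<close>

lemma profile_separation_aux:
  assumes "\<sigma> > 0" and "\<epsilon> > 0" and fin: "finite I" "finite J" and p: "p \<in> I" "p \<notin> J"
    and min: "\<And>j. j \<in> (I - J) \<union> (J - I) \<Longrightarrow> p \<le> j"
  shows "1 / 2 < (\<Sum>j\<in>I. profile \<sigma> \<epsilon> (\<epsilon> * of_int j - \<epsilon> * of_int p)) -
    (\<Sum>j\<in>J. profile \<sigma> \<epsilon> (\<epsilon> * of_int j - \<epsilon> * of_int p))"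
proof -
  define f where "f j = profile \<sigma> \<epsilon> (\<epsilon> * of_int j - \<epsilon> * of_int p)" for j
  define R where "R = (I - J - {p}) \<union> (J - I)"
  have finR: "finite R" using fin by (simp add: R_def)
  have f: "\<bar>f j\<bar> \<le> 1 / 8 * (1 / (1 + (real (nat (j - p)))\<^sup>2))" if "j \<in> R" for j
  proof -
    have "j > p" using min[of j] that p by (auto simp: R_def order_less_le)
    then have n: "real (nat (j - p)) = of_int j - of_int p" "of_int j - of_int p \<ge> (1::real)"
      by (simp, linarith)
    define x where "x = (of_int j - of_int p :: real)"
    have "\<bar>f j\<bar> \<le> 1 / (16 * x\<^sup>2)"
      using abs_profile_le[OF assms(1,2), of x] n(2) by (simp add: f_def x_def algebra_simps)
    \<comment> \<open>Here \<open>x \<ge> 1\<close>, hence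
      \<open>1 + x^2 \<le> 2 * x^2\<close>.\<close>
    also have "\<dots> \<le> 1 / (8 * (1 + x\<^sup>2))"
      using one_le_power[of x 2] n(2)
      by (intro divide_left_mono mult_pos_pos) (auto simp: x_def add_pos_nonneg)
    finally show ?thesis by (simp add: n(1) x_def)
  qed
  have inj: "inj_on (\<lambda>j. nat (j - p)) R"
  proof (rule inj_onI)
    fix x y assume "x \<in> R" "y \<in> R" and eq: "nat (x - p) = nat (y - p)"
    then have "p \<le> x" "p \<le> y" using min by (auto simp: R_def)
    with eq show "x = y" by simp
  qed
  have "(\<Sum>j\<in>I. f j) - (\<Sum>j\<in>J. f j) = (\<Sum>j\<in>I - J. f j) - (\<Sum>j\<in>J - I. f j)"
    using fin sum.Int_Diff[of I f J] sum.Int_Diff[of J f I] by (simp add: Int_commute)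
  also have "(\<Sum>j\<in>I - J. f j) = f p + (\<Sum>j\<in>I - J - {p}. f j)"
    using fin p by (intro sum.remove) auto
  also have "f p = 1" using assms(1,2) by (simp add: f_def profile_0)
  finally have eq: "(\<Sum>j\<in>I. f j) - (\<Sum>j\<in>J. f j) = 1 + (\<Sum>j\<in>I - J - {p}. f j) - (\<Sum>j\<in>J - I. f j)" .
  have "\<bar>\<Sum>j\<in>I - J - {p}. f j\<bar> + \<bar>\<Sum>j\<in>J - I. f j\<bar> \<le> (\<Sum>j\<in>I - J - {p}. \<bar>f j\<bar>) + (\<Sum>j\<in>J - I. \<bar>f j\<bar>)"
    by (intro add_mono sum_abs)
  also have "\<dots> = (\<Sum>j\<in>R. \<bar>f j\<bar>)"
    using fin unfolding R_def by (intro sum.union_disjoint[symmetric]) auto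
  also have "\<dots> \<le> (\<Sum>j\<in>R. 1 / 8 * (1 / (1 + (real (nat (j - p)))\<^sup>2)))"
    by (intro sum_mono f)
  also have "\<dots> = 1 / 8 * (\<Sum>j\<in>(\<lambda>j. nat (j - p)) ` R. 1 / (1 + (real j)\<^sup>2))"
    using inj by (simp add: sum.reindex sum_distrib_left)
  also have "\<dots> \<le> 1 / 8 * 3"
    using finR by (intro mult_left_mono sum_inverse_one_plus_square_le) auto
  finally show ?thesis
    using eq unfolding f_def by linarith
qed

text \<open>Take \<open>p\<close> as the least point of the symmetric difference; the absolute value
  allows exchanging \<open>I\<close> and \<open>J\<close> according to which set contains
  it.\<close>

lemma profile_separation:
  fixes I J :: "int set"
  assumes "\<sigma> > 0" and "\<epsilon> > 0" and fin: "finite I" "finite J" and "I \<noteq> J"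
  shows "\<exists>p. 1 / 2 < \<bar>(\<Sum>j\<in>I. profile \<sigma> \<epsilon> (\<epsilon> * of_int j - \<epsilon> * of_int p)) -
    (\<Sum>j\<in>J. profile \<sigma> \<epsilon> (\<epsilon> * of_int j - \<epsilon> * of_int p))\<bar>"
proof -
  define D where "D = (I - J) \<union> (J - I)"
  define p where "p = Min D"
  have D: "finite D" "D \<noteq> {}" using fin \<open>I \<noteq> J\<close> by (auto simp: D_def)
  have pD: "p \<in> D" and min: "\<And>j. j \<in> D \<Longrightarrow> p \<le> j"
    using D by (simp_all add: p_def)
  show ?thesis
  proof (cases "p \<in> I")
    case True
    then have "p \<notin> J" using pD by (auto simp: D_def)
    from profile_separation_aux[OF assms(1-4) True this] min show ?thesis
      by (intro exI[of _ p]) (auto simp: D_def)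
  next
    case False
    then have "p \<in> J" using pD by (auto simp: D_def)
    moreover have "\<And>j. j \<in> (J - I) \<union> (I - J) \<Longrightarrow> p \<le> j" using min by (auto simp: D_def)
    ultimately show ?thesis
      using profile_separation_aux[OF assms(1,2) fin(2,1) _ False] by (intro exI[of _ p]) fastforce
  qed
qed

section \<open>The estimator\<close>

text \<open>The sum over \<open>S\<close>, divided by \<open>k\<close>, is the expectation of the empirical mean when \<open>S\<close> is the
  set of means.\<close>

definition hypothesis_fits :: "nat \<Rightarrow> real \<Rightarrow> real \<Rightarrow> nat \<Rightarrow> real set \<Rightarrow> (nat \<Rightarrow> real) \<Rightarrow> bool" where
  "hypothesis_fits k \<sigma> \<epsilon> m S x \<longleftrightarrow> (\<forall>n::int.
     \<bar>(\<Sum>i<m. probe \<sigma> \<epsilon> (x i - \<epsilon> * of_int n)) / real m -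
      (\<Sum>a\<in>S. profile \<sigma> \<epsilon> (a - \<epsilon> * of_int n)) / real k\<bar> < 1 / (4 * real k))"

text \<open>Two fitting sets lie within \<open>1 / (4 * k)\<close> of the same empirical means, so
  their profile sums differ by less than 1/2 at every lattice point, against
  \<open>profile_separation\<close>.\<close>

lemma hypothesis_fits_unique:
  assumes "\<sigma> > 0" and \<epsilon>: "\<epsilon> > 0" and k: "k \<ge> 1"
    and S: "S \<subseteq> scaled_integers \<epsilon>" "finite S" and T: "T \<subseteq> scaled_integers \<epsilon>" "finite T"
    and fits: "hypothesis_fits k \<sigma> \<epsilon> m S x" "hypothesis_fits k \<sigma> \<epsilon> m T x"
  shows "S = T"
proof (rule ccontr)
  assume "S \<noteq> T"
  have "scaled_integers \<epsilon> = range (\<lambda>j. \<epsilon> * of_int j)"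
    by (auto simp: scaled_integers_def)
  then obtain I J where I: "S = (\<lambda>j. \<epsilon> * of_int j) ` I" "finite I" and J: "T = (\<lambda>j. \<epsilon> * of_int j) ` J" "finite J"
    using S T by (metis finite_subset_image)
  have inj: "inj_on (\<lambda>j::int. \<epsilon> * of_int j) A" for A
    using \<epsilon> by (auto simp: inj_on_def)
  from \<open>S \<noteq> T\<close> have "I \<noteq> J" using I J by auto
  from profile_separation[OF assms(1,2) I(2) J(2) this] obtain p where
    p: "1 / 2 < \<bar>(\<Sum>j\<in>I. profile \<sigma> \<epsilon> (\<epsilon> * of_int j - \<epsilon> * of_int p)) -
      (\<Sum>j\<in>J. profile \<sigma> \<epsilon> (\<epsilon> * of_int j - \<epsilon> * of_int p))\<bar>" by blast
  define s t e where "s = (\<Sum>a\<in>S. profile \<sigma> \<epsilon> (a - \<epsilon> * of_int p))"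
    and "t = (\<Sum>a\<in>T. profile \<sigma> \<epsilon> (a - \<epsilon> * of_int p))"
    and "e = (\<Sum>i<m. probe \<sigma> \<epsilon> (x i - \<epsilon> * of_int p)) / real m"
  have "1 / 2 < \<bar>s - t\<bar>"
    using p unfolding s_def t_def I(1) J(1) by (simp add: sum.reindex inj)
  have "\<bar>e - s / real k\<bar> < 1 / (4 * real k)" "\<bar>e - t / real k\<bar> < 1 / (4 * real k)"
    using fits by (simp_all add: hypothesis_fits_def s_def t_def e_def)
  then have "\<bar>s / real k - t / real k\<bar> < 1 / (4 * real k) + 1 / (4 * real k)"
    by linarith
  also have "\<dots> = 1 / 2 / real k" by simp
  finally have "\<bar>s - t\<bar> / real k < 1 / 2 / real k"
    using k by (simp flip: diff_divide_distrib)
  then have "\<bar>s - t\<bar> < 1 / 2 / real k * real k"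
    using k by (subst (asm) pos_divide_less_eq) auto
  also have "\<dots> = 1 / 2" using k by simp
  finally show False using \<open>1 / 2 < \<bar>s - t\<bar>\<close> by simp
qed

lemma measure_hypothesis_fits:
  assumes k: "k \<ge> 1" and \<sigma>: "\<sigma> > 0" and \<epsilon>: "\<epsilon> > 0" and m: "m > 0" and inj: "inj_on \<mu> {..<k}"
  shows "measure (iid_samples m (gaussian_mixture k \<mu> \<sigma>))
      {x \<in> space (iid_samples m (gaussian_mixture k \<mu> \<sigma>)). hypothesis_fits k \<sigma> \<epsilon> m (\<mu> ` {..<k}) x}
    \<ge> 1 - 4800 * (real k)\<^sup>2 * exp (195 * (\<sigma> / \<epsilon>) powr (2 / 3)) / real m"
proof -
  define M where "M = gaussian_mixture k \<mu> \<sigma>"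
  define B where "B = 300 * exp (195 * (\<sigma> / \<epsilon>) powr (2 / 3))"
  \<comment> \<open>The bijection \<open>int_decode\<close> turns the translates indexed by integers
    into a sequence.\<close>
  define h where "h n x = probe \<sigma> \<epsilon> (x - \<epsilon> * of_int (int_decode n))" for n x
  note [measurable] = borel_measurable_probe[OF \<sigma> \<epsilon>]
  have [measurable]: "h n \<in> borel_measurable borel" for n
    by (simp add: h_def[abs_def])
  have bnd: "(\<Sum>n<N. (h n x)\<^sup>2) \<le> B" for N x
  proof -
    have "(\<Sum>n<N. (h n x)\<^sup>2) = (\<Sum>n\<in>int_decode ` {..<N}. (probe \<sigma> \<epsilon> (x - \<epsilon> * of_int n))\<^sup>2)"
      by (subst sum.reindex) (auto simp: h_def inj_int_decode)
    also have "\<dots> \<le> B"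
      unfolding B_def by (intro sum_probe_square_le \<sigma> \<epsilon>) auto
    finally show ?thesis .
  qed
  have mean: "(\<integral>y. h n y \<partial>M) = (\<Sum>a\<in>\<mu> ` {..<k}. profile \<sigma> \<epsilon> (a - \<epsilon> * of_int (int_decode n))) / real k" for n
  proof -
    have "(h n x)\<^sup>2 \<le> B" for x
      using bnd[where N = "Suc n" and x = x] sum_nonneg[of "{..<n}" "\<lambda>n. (h n x)\<^sup>2"] by simp
    then have "\<bar>h n x\<bar> \<le> sqrt B" for x
      using real_sqrt_le_mono[of "(h n x)\<^sup>2" B] by simp
    then show ?thesis
      unfolding M_def using inj
      by (subst integral_gaussian_mixture[where K = "sqrt B"])
        (auto simp: h_def integral_shifted_probe \<sigma> \<epsilon> sum.reindex)
  qed
  have iff: "(\<forall>n. \<bar>(\<Sum>i<m. h n (x i)) / real m - (\<integral>y. h n y \<partial>M)\<bar> < 1 / (4 * real k))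
    \<longleftrightarrow> hypothesis_fits k \<sigma> \<epsilon> m (\<mu> ` {..<k}) x" for x
  proof -
    define Q where "Q n \<longleftrightarrow> \<bar>(\<Sum>i<m. probe \<sigma> \<epsilon> (x i - \<epsilon> * of_int n)) / real m -
      (\<Sum>a\<in>\<mu> ` {..<k}. profile \<sigma> \<epsilon> (a - \<epsilon> * of_int n)) / real k\<bar> < 1 / (4 * real k)" for n
    have "(\<forall>n. Q (int_decode n)) \<longleftrightarrow> (\<forall>n. Q n)"
      by (metis int_encode_inverse)
    then show ?thesis
      by (simp only: mean) (simp only: Q_def h_def hypothesis_fits_def)
  qed
  have "1 - B / (real m * (1 / (4 * real k))\<^sup>2) \<le> measure (iid_samples m M)
      {x \<in> space (iid_samples m M). hypothesis_fits k \<sigma> \<epsilon> m (\<mu> ` {..<k}) x}"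
    using k m unfolding iff[symmetric] unfolding M_def
    by (intro iid_samples_uniform_deviation bnd prob_space_gaussian_mixture \<sigma>) auto
  \<comment> \<open>4800 = 300 * 16, the 16 coming from the squared tolerance.\<close>
  also have "B / (real m * (1 / (4 * real k))\<^sup>2) = 4800 * (real k)\<^sup>2 * exp (195 * (\<sigma> / \<epsilon>) powr (2 / 3)) / real m"
    using k m by (simp add: B_def power_divide power_mult_distrib)
  finally show ?thesis by (simp only: M_def)
qed

section \<open>Enumeration of the hypotheses and measurability\<close>

lemma countable_lattice_subsets:
  "countable {S. S \<subseteq> scaled_integers \<epsilon> \<and> finite S \<and> card S = k}"
proof -
  have "scaled_integers \<epsilon> = range (\<lambda>j. \<epsilon> * of_int j)"
    by (auto simp: scaled_integers_def)
  then have "countable (scaled_integers \<epsilon>)" by simp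
  then show ?thesis
    by (rule countable_subset[OF _ countable_Collect_finite_subset, rotated]) auto
qed

text \<open>If no hypothesis fits, \<open>LEAST\<close> is an unspecified index, but the value is still a
  \<open>k\<close>-element subset of the lattice.\<close>

definition first_fit_estimator :: "nat \<Rightarrow> real \<Rightarrow> real \<Rightarrow> nat \<Rightarrow> (nat \<Rightarrow> real) \<Rightarrow> real set" where
  "first_fit_estimator k \<sigma> \<epsilon> m x =
     (let H = from_nat_into {S. S \<subseteq> scaled_integers \<epsilon> \<and> finite S \<and> card S = k}
      in H (LEAST j. hypothesis_fits k \<sigma> \<epsilon> m (H j) x))"

lemma lattice_subsets_nonempty:
  assumes "\<epsilon> > 0"
  shows "{S. S \<subseteq> scaled_integers \<epsilon> \<and> finite S \<and> card S = k} \<noteq> {}"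
proof -
  have "(\<lambda>j. \<epsilon> * of_int (int j)) ` {..<k} \<in> {S. S \<subseteq> scaled_integers \<epsilon> \<and> finite S \<and> card S = k}"
    using assms by (auto simp: scaled_integers_def card_image inj_on_def intro: exI[of _ "int _"])
  then show ?thesis by blast
qed

text \<open>Fitting is a countable conjunction of Borel conditions, so the least fitting index is
  measurable; nonemptiness of the family keeps every enumerated value inside the codomain.\<close>

lemma first_fit_estimator_measurable:
  assumes \<sigma>: "\<sigma> > 0" and \<epsilon>: "\<epsilon> > 0"
  shows "first_fit_estimator k \<sigma> \<epsilon> m \<in> mean_estimators k \<epsilon> m"
proof -
  define \<S> where "\<S> = {S. S \<subseteq> scaled_integers \<epsilon> \<and> finite S \<and> card S = k}"
  have ne: "\<S> \<noteq> {}" using \<epsilon> by (simp only: \<S>_def lattice_subsets_nonempty not_False_eq_True)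
  note [measurable] = borel_measurable_probe[OF \<sigma> \<epsilon>]
  have "Measurable.pred (\<Pi>\<^sub>M i\<in>{..<m}. borel) (\<lambda>x. hypothesis_fits k \<sigma> \<epsilon> m S x)" for S
    unfolding hypothesis_fits_def by measurable
  then have "(\<lambda>x. LEAST j. hypothesis_fits k \<sigma> \<epsilon> m (from_nat_into \<S> j) x)
      \<in> measurable (\<Pi>\<^sub>M i\<in>{..<m}. borel) (count_space UNIV)"
    by (intro measurable_Least)
  moreover have "from_nat_into \<S> \<in> measurable (count_space UNIV) (count_space \<S>)"
    using ne by (simp add: from_nat_into)
  ultimately have "(\<lambda>x. from_nat_into \<S> (LEAST j. hypothesis_fits k \<sigma> \<epsilon> m (from_nat_into \<S> j) x))
      \<in> measurable (\<Pi>\<^sub>M i\<in>{..<m}. borel) (count_space \<S>)"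
    by (rule measurable_compose)
  then show ?thesis
    by (simp add: mean_estimators_def first_fit_estimator_def[abs_def] \<S>_def Let_def)
qed

text \<open>Countability lets the enumeration reach \<open>S\<close>, so some index fits and the
  least one does too; uniqueness identifies its set with \<open>S\<close>.\<close>

lemma first_fit_estimator_eqI:
  assumes "k \<ge> 1" and "\<sigma> > 0" and "\<epsilon> > 0"
    and S: "S \<subseteq> scaled_integers \<epsilon>" "finite S" "card S = k" and fits: "hypothesis_fits k \<sigma> \<epsilon> m S x"
  shows "first_fit_estimator k \<sigma> \<epsilon> m x = S"
proof -
  define \<S> where "\<S> = {S. S \<subseteq> scaled_integers \<epsilon> \<and> finite S \<and> card S = k}"
  have "S \<in> \<S>" using S by (simp add: \<S>_def)
  moreover have "countable \<S>"
    unfolding \<S>_def by (rule countable_lattice_subsets)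
  ultimately obtain j where "from_nat_into \<S> j = S"
    by (metis from_nat_into_surj)
  with fits have "hypothesis_fits k \<sigma> \<epsilon> m (from_nat_into \<S> j) x" by simp
  then have *: "hypothesis_fits k \<sigma> \<epsilon> m (first_fit_estimator k \<sigma> \<epsilon> m x) x"
    unfolding first_fit_estimator_def Let_def \<S>_def[symmetric]
    by (rule LeastI[where P = "\<lambda>j. hypothesis_fits k \<sigma> \<epsilon> m (from_nat_into \<S> j) x"])
  have "first_fit_estimator k \<sigma> \<epsilon> m x \<in> \<S>"
    unfolding first_fit_estimator_def Let_def \<S>_def[symmetric]
    using \<open>S \<in> \<S>\<close> by (intro from_nat_into) auto
  then have T: "first_fit_estimator k \<sigma> \<epsilon> m x \<subseteq> scaled_integers \<epsilon>"
    "finite (first_fit_estimator k \<sigma> \<epsilon> m x)"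
    unfolding \<S>_def by blast+
  show ?thesis
    by (rule hypothesis_fits_unique[OF assms(2,3,1) T S(1,2) * fits])
qed

theorem theorem1:
  fixes \<delta> :: real
  assumes "0 < \<delta>" and "\<delta> < 1"
  shows "\<exists>C::real. C > 0 \<and>
    (\<forall>(k::nat) (\<sigma>::real) (\<epsilon>::real) (m::nat).
      k \<ge> 1 \<longrightarrow> \<sigma> > 0 \<longrightarrow> \<epsilon> > 0 \<longrightarrow>
      real m \<ge> C * real k ^ 3 * exp (C * (\<sigma> / \<epsilon>) powr (2 / 3)) \<longrightarrow>
      (\<exists>A \<in> mean_estimators k \<epsilon> m.
        \<forall>\<mu> :: nat \<Rightarrow> real.
          inj_on \<mu> {..<k} \<longrightarrow> (\<forall>i<k. \<mu> i \<in> scaled_integers \<epsilon>) \<longrightarrow>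
          measure (iid_samples m (gaussian_mixture k \<mu> \<sigma>))
            {x \<in> space (iid_samples m (gaussian_mixture k \<mu> \<sigma>)). A x = \<mu> ` {..<k}}
          \<ge> 1 - \<delta>))"
proof (intro exI conjI allI impI)
  \<comment> \<open>One constant serves twice: as prefactor it brings the error of
    \<open>measure_hypothesis_fits\<close> below \<open>\<delta>\<close>, and in the exponent it
    exceeds 195 because \<open>\<delta> < 1\<close>.\<close>
  show C: "4800 / \<delta> > 0" using assms by simp
  fix k :: nat and \<sigma> \<epsilon> :: real and m :: nat
  assume k: "k \<ge> 1" and \<sigma>: "\<sigma> > 0" and \<epsilon>: "\<epsilon> > 0"
    and m: "real m \<ge> 4800 / \<delta> * real k ^ 3 * exp (4800 / \<delta> * (\<sigma> / \<epsilon>) powr (2 / 3))"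
  define E where "E = exp (195 * (\<sigma> / \<epsilon>) powr (2 / 3))"
  have "4800 / \<delta> * (real k)\<^sup>2 * E \<le> 4800 / \<delta> * real k ^ 3 * exp (4800 / \<delta> * (\<sigma> / \<epsilon>) powr (2 / 3))"
  proof -
    have "195 \<le> 4800 / \<delta>" using assms by (simp add: field_simps)
    then have "E \<le> exp (4800 / \<delta> * (\<sigma> / \<epsilon>) powr (2 / 3))"
      unfolding E_def exp_le_cancel_iff by (intro mult_right_mono) auto
    then show ?thesis
      using C k by (intro mult_mono power_increasing) (auto simp: E_def)
  qed
  also note m
  finally have m': "4800 / \<delta> * (real k)\<^sup>2 * E \<le> real m" .
  moreover have "4800 / \<delta> * (real k)\<^sup>2 * E > 0"
    using C k by (simp add: E_def)
  ultimately have m0: "m > 0" by linarith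
  have err: "4800 * (real k)\<^sup>2 * E / real m \<le> \<delta>"
    using m' m0 assms by (simp add: field_simps)
  show "\<exists>A \<in> mean_estimators k \<epsilon> m. \<forall>\<mu> :: nat \<Rightarrow> real.
      inj_on \<mu> {..<k} \<longrightarrow> (\<forall>i<k. \<mu> i \<in> scaled_integers \<epsilon>) \<longrightarrow>
      measure (iid_samples m (gaussian_mixture k \<mu> \<sigma>))
        {x \<in> space (iid_samples m (gaussian_mixture k \<mu> \<sigma>)). A x = \<mu> ` {..<k}}
      \<ge> 1 - \<delta>"
  proof (intro bexI[OF _ first_fit_estimator_measurable[OF \<sigma> \<epsilon>]] allI impI)
    fix \<mu> :: "nat \<Rightarrow> real"
    assume inj: "inj_on \<mu> {..<k}" and lat: "\<forall>i<k. \<mu> i \<in> scaled_integers \<epsilon>"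
    define P where "P = iid_samples m (gaussian_mixture k \<mu> \<sigma>)"
    define \<S> where "\<S> = {S. S \<subseteq> scaled_integers \<epsilon> \<and> finite S \<and> card S = k}"
    have \<mu>: "\<mu> ` {..<k} \<in> \<S>"
      using inj lat by (auto simp: \<S>_def card_image)
    interpret P: prob_space P
      unfolding P_def iid_samples_def by (intro prob_space_PiM prob_space_gaussian_mixture k \<sigma>)
    have "first_fit_estimator k \<sigma> \<epsilon> m \<in> measurable P (count_space \<S>)"
      using first_fit_estimator_measurable[OF \<sigma> \<epsilon>, of k m]
      unfolding mean_estimators_def P_def iid_samples_def \<S>_def
      by (simp cong: measurable_cong_sets sets_PiM_cong)
    \<comment> \<open>The success event is the preimage of a singleton; its measurability is
      required for monotonicity of the measure.\<close>
    from measurable_sets[OF this, of "{\<mu> ` {..<k}}"] \<mu>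
    have sets: "{x \<in> space P. first_fit_estimator k \<sigma> \<epsilon> m x = \<mu> ` {..<k}} \<in> sets P"
      by (simp add: vimage_def Int_def conj_commute)
    have "1 - \<delta> \<le> 1 - 4800 * (real k)\<^sup>2 * E / real m"
      using err by simp
    also have "\<dots> \<le> measure P {x \<in> space P. hypothesis_fits k \<sigma> \<epsilon> m (\<mu> ` {..<k}) x}"
      unfolding P_def E_def by (intro measure_hypothesis_fits k \<sigma> \<epsilon> m0 inj)
    also have "\<dots> \<le> measure P {x \<in> space P. first_fit_estimator k \<sigma> \<epsilon> m x = \<mu> ` {..<k}}"
    proof (intro P.finite_measure_mono sets Collect_mono conj_mono)
      fix x
      show "hypothesis_fits k \<sigma> \<epsilon> m (\<mu> ` {..<k}) x \<longrightarrow> first_fit_estimator k \<sigma> \<epsilon> m x = \<mu> ` {..<k}"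
        using \<mu> by (intro impI first_fit_estimator_eqI k \<sigma> \<epsilon>) (simp_all add: \<S>_def)
    qed simp
    finally show "measure (iid_samples m (gaussian_mixture k \<mu> \<sigma>))
        {x \<in> space (iid_samples m (gaussian_mixture k \<mu> \<sigma>)). first_fit_estimator k \<sigma> \<epsilon> m x = \<mu> ` {..<k}}
      \<ge> 1 - \<delta>"
      unfolding P_def .
  qed
qed

end
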